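(* Let $0<a<b<\infty$, let $p>1$, $\alpha\in\left(\frac1p,1\right]$ and $\gamma\in\mathbb{R}$. Then there is a constant $C>0$, independent of $u$, such that for every $u\in AC[a,b]$ with $u(a)=0$ and $\mathfrak{D}^{\alpha}_{a+}u\in L^p_{\frac1x}(a,b)$, where $\mathfrak{D}^{\alpha}_{a+}$ is the left Hadamard fractional derivative of order $\alpha$, one has $$\left\|\frac{u}{x^{\gamma+1}}\right\|_{L^p(a,b)}\leq C \left\|\frac{\mathfrak{D}^{\alpha}_{a+}u}{x^{\gamma}}\right\|_{L_{\frac{1}{x}}^p(a,b)}.$$
   Context: $AC[a,b]$ is the space of (real- or complex-valued) absolutely continuous functions on $[a,b]$, $x$ denotes the variable in $(a,b)$, and $\Gamma$ is the Euler gamma function. For $0<\alpha<1$ and $f\in AC[a,b]$ the left Hadamard fractional derivative (of Caputo type) is $\mathfrak{D}_{a+}^{\alpha}f(t)=\frac{1}{\Gamma(1-\alpha)}\int_{a}^{t}\left(\log\frac{t}{s}\right)^{-\alpha}s f'(s)\,\frac{ds}{s}$ (for almost every $t\in(a,b]$), and for $\alpha=1$, $\mathfrak{D}_{a+}^1f(t)=t f'(t)$. For $p\ge1$, $\|v\|_{L^{p}_{\frac{1}{x}}(a,b)}=\left(\int_{a}^{b}|v(x)|^{p}\frac{dx}{x}\right)^{1/p}$, and $L^p_{\frac1x}(a,b)$ is the corresponding weighted Lebesgue space. *)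

theory Defs
  imports "HOL-Analysis.Analysis"
begin

text \<open>
  Absolute continuity of a function on \<open>[a,b]\<close>; the library notion
  \<^const>\<open>absolutely_continuous\<close> is about measures. Degenerate intervals \<open>s i = t i\<close> are
  admitted, but contribute nothing to either sum.
\<close>

definition abs_continuous_on :: "real \<Rightarrow> real \<Rightarrow> (real \<Rightarrow> 'a::real_normed_vector) \<Rightarrow> bool" where
  "abs_continuous_on a b f \<longleftrightarrow>
    (\<forall>\<epsilon>>0. \<exists>\<delta>>0. \<forall>(n::nat) s t.
       (\<forall>i<n. a \<le> s i \<and> s i \<le> t i \<and> t i \<le> b) \<and>
       disjoint_family_on (\<lambda>i. {s i<..<t i}) {..<n} \<and>
       (\<Sum>i<n. t i - s i) < \<delta>
       \<longrightarrow> (\<Sum>i<n. norm (f (t i) - f (s i))) < \<epsilon>)"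

text \<open>
  Left Hadamard fractional derivative of Caputo type, meant for \<open>0 < \<alpha> \<le> 1\<close>. The derivative of
  an absolutely continuous function exists almost everywhere, and for \<open>\<alpha> < 1\<close> the integral
  converges absolutely for almost every \<open>t\<close>; the default values that
  \<^const>\<open>vector_derivative\<close> and the Lebesgue integral take elsewhere only affect a null set.
\<close>

definition hadamard_deriv ::
  "real \<Rightarrow> real \<Rightarrow> (real \<Rightarrow> 'a::{banach,second_countable_topology}) \<Rightarrow> real \<Rightarrow> 'a" where
  "hadamard_deriv a \<alpha> f t =
    (if \<alpha> = 1 then t *\<^sub>R vector_derivative f (at t)
     else (1 / Gamma (1 - \<alpha>)) *\<^sub>R
       (LINT s:{a..t}|lebesgue. (ln (t / s) powr (- \<alpha>) / s) *\<^sub>R (s *\<^sub>R vector_derivative f (at s))))"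

text \<open>
  The norm of \<open>L\<^sup>p\<close> on \<open>(a,b)\<close> with weight \<open>w\<close>, that is
  \<open>(\<integral>\<^sub>a\<^sup>b |v(x)|\<^sup>p w(x) dx)\<^bsup>1/p\<^esup>\<close>. It is \<^typ>\<open>ennreal\<close>-valued, so that a divergent
  integral gives \<open>\<infinity>\<close>; the case distinction is the power \<open>1/p\<close> on \<^typ>\<open>ennreal\<close>.
\<close>

definition weighted_Lp_norm ::
  "real \<Rightarrow> (real \<Rightarrow> real) \<Rightarrow> real \<Rightarrow> real \<Rightarrow> (real \<Rightarrow> 'a::real_normed_vector) \<Rightarrow> ennreal" where
  "weighted_Lp_norm p w a b v =
    (let I = \<integral>\<^sup>+x\<in>{a<..<b}. ennreal (norm (v x) powr p * w x) \<partial>lebesgue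
     in if I = \<infinity> then \<infinity> else ennreal (enn2real I powr (1 / p)))"

definition weighted_Lp ::
  "real \<Rightarrow> (real \<Rightarrow> real) \<Rightarrow> real \<Rightarrow> real \<Rightarrow> (real \<Rightarrow> 'a::real_normed_vector) set" where
  "weighted_Lp p w a b =
    {v. set_borel_measurable lebesgue {a<..<b} v \<and> weighted_Lp_norm p w a b v < \<infinity>}"

end

theory Submission
  imports Defs
begin

text \<open>
  An absolutely continuous \<open>u\<close> with \<open>u(a) = 0\<close> is recovered from its Hadamard derivative \<open>w\<close> by
  \<open>u(t) = \<Gamma>(\<alpha>)\<^sup>-\<^sup>1 \<integral>\<^sub>a\<^sup>t (log (t/s))\<^bsup>\<alpha>-1\<^esup> w(s) ds/s\<close>: insert the definition of \<open>w\<close>, exchange the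
  integrals, and evaluate the inner one as a Beta integral. Since \<open>\<alpha> > 1/p\<close>, the kernel belongs to
  \<open>L\<^sup>q\<close> with respect to \<open>ds/s\<close>, uniformly in \<open>t\<close>, so Hoelder's inequality bounds \<open>u\<close> uniformly by the
  weighted \<open>L\<^sup>p\<close> norm of \<open>w\<close>; the powers of \<open>x\<close> are harmless because \<open>0 < a \<le> x \<le> b\<close>.
  The integral formula needs \<open>u(t) = \<integral>\<^sub>a\<^sup>t u'\<close>. Almost everywhere differentiability is Austin's
  variation argument based on the Vitali covering theorem. The fundamental theorem of calculus then
  follows for the gauge integral: away from the exceptional null set the gauge comes from
  differentiability, and on it from an open neighbourhood of small measure.
\<close>

section \<open>Families of non-overlapping intervals\<close>

text \<open>Exchanging the integrals requires absolute convergence, but the gauge form of the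
  fundamental theorem gives only conditional integrability of the derivative. Absolute integrability
  is therefore proved separately, from the bounded variation of \<open>u\<close> on short intervals;
  Tonelli's theorem then justifies the exchange, because the kernel integrates to the same constant
  for every inner point. Only the inequality for \<open>norm (u t)\<close> that results from the
  integral formula is kept. With 1/p + 1/q = 1, the condition \<alpha> > 1/p says that (\<alpha> -
  1) q > -1, which is exactly integrability at s = t of the q-th power of the logarithmic kernel
  against ds/s. Since the bound on \<open>u\<close> is uniform in \<open>t\<close>, passing to the
  norm on the left costs only a factor (b - a)^(1/p) and the extreme values of a power of x.\<close>

definition interval_family :: "real \<Rightarrow> real \<Rightarrow> (real \<times> real) set \<Rightarrow> bool" where
  "interval_family a b P \<longleftrightarrow> finite P \<and> (\<forall>(s, t)\<in>P. a \<le> s \<and> s < t \<and> t \<le> b) \<and>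
     pairwise (\<lambda>(s, t) (s', t'). t \<le> s' \<or> t' \<le> s) P"

lemma interval_familyD:
  assumes "interval_family a b P"
  shows "finite P"
    and "(s, t) \<in> P \<Longrightarrow> a \<le> s" and "(s, t) \<in> P \<Longrightarrow> s < t" and "(s, t) \<in> P \<Longrightarrow> t \<le> b"
    and "(s, t) \<in> P \<Longrightarrow> (s', t') \<in> P \<Longrightarrow> (s, t) \<noteq> (s', t') \<Longrightarrow> t \<le> s' \<or> t' \<le> s"
  using assms by (fastforce simp: interval_family_def pairwise_def)+

lemma interval_familyI:
  assumes "finite P" and "\<And>s t. (s, t) \<in> P \<Longrightarrow> a \<le> s \<and> s < t \<and> t \<le> b"
    and "\<And>s t s' t'. (s, t) \<in> P \<Longrightarrow> (s', t') \<in> P \<Longrightarrow> (s, t) \<noteq> (s', t') \<Longrightarrow> t \<le> s' \<or> t' \<le> s"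
  shows "interval_family a b P"
  using assms unfolding interval_family_def pairwise_def by fast

lemma interval_family_subset:
  assumes "interval_family a b P" "Q \<subseteq> P" "\<And>s t. (s, t) \<in> Q \<Longrightarrow> a' \<le> s \<and> t \<le> b'"
  shows "interval_family a' b' Q"
  using assms interval_familyD[OF assms(1)]
  by (intro interval_familyI) (blast intro: finite_subset)+

lemma interval_family_empty [simp]: "interval_family a b {}"
  by (simp add: interval_family_def)

text \<open>The gaps between the intervals only contribute further nonnegative increments of
  \<open>g\<close>. The induction removes the interval with the largest right endpoint; all others
  then lie to the left of \<open>s\<close>.\<close>

lemma sum_increments_le:
  fixes g :: "real \<Rightarrow> real"
  assumes "interval_family a b P" and "mono_on {a..b} g" and "a \<le> b"
  shows "(\<Sum>(s, t)\<in>P. g t - g s) \<le> g b - g a"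
  using assms
proof (induction "card P" arbitrary: b P)
  case 0
  then have "P = {}"
    using interval_familyD(1) by fastforce
  with 0 show ?case
    by (auto simp: mono_on_def)
next
  case (Suc n)
  note P = interval_familyD[OF Suc.prems(1)]
  have ne: "snd ` P \<noteq> {}" "finite (snd ` P)"
    using Suc.hyps(2) P(1) by auto
  then obtain s t where st: "(s, t) \<in> P" "t = Max (snd ` P)"
    using Max_in by (metis imageE prod.collapse)
  have max: "t' \<le> t" if "(s', t') \<in> P" for s' t'
    using that ne st Max_ge by (metis image_eqI snd_conv)
  let ?Q = "P - {(s, t)}"
  have Q: "interval_family a s ?Q"
  proof (rule interval_family_subset[OF Suc.prems(1)])
    fix s' t' assume *: "(s', t') \<in> ?Q"
    then have "t' \<le> s \<or> t \<le> s'"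
      using P(5)[of s t s' t'] st(1) by auto
    moreover have "\<not> t \<le> s'"
      using * P(3)[of s' t'] max[of s' t'] by auto
    ultimately show "a \<le> s' \<and> t' \<le> s"
      using * P(2)[of s' t'] by auto
  qed auto
  have le: "a \<le> s" "s < t" "t \<le> b"
    using P(2-4) st(1) by auto
  have "(\<Sum>(s, t)\<in>?Q. g t - g s) \<le> g s - g a"
  proof (rule Suc.hyps(1))
    show "n = card ?Q"
      using Suc.hyps(2) st(1) P(1) by simp
    show "mono_on {a..s} g"
      using Suc.prems(2) le by (auto intro: mono_on_subset)
  qed (use Q le in auto)
  moreover have "(\<Sum>(s, t)\<in>P. g t - g s) = g t - g s + (\<Sum>(s, t)\<in>?Q. g t - g s)"
    using sum.remove[OF P(1) st(1), of "\<lambda>(s, t). g t - g s"] by simp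
  moreover have "g t \<le> g b"
    using Suc.prems(2) le by (auto simp: mono_on_def)
  ultimately show ?case
    by linarith
qed

text \<open>Turns a bound on total lengths of finite families into a bound on outer measure, with no
  measurability of \<open>S\<close>. Vitali's theorem selects countably many disjoint intervals of
  \<open>K\<close> covering almost all of \<open>S - N\<close>; their finite unions have measure at
  most \<open>B\<close>, hence so does the whole union.\<close>

lemma Vitali_interval_cover:
  fixes S N :: "real set"
  assumes cover: "\<And>x e. x \<in> S - N \<Longrightarrow> 0 < e \<Longrightarrow> \<exists>p q. (p, q) \<in> K \<and> p \<le> x \<and> x \<le> q \<and> q - p < e"
    and K: "\<And>p q. (p, q) \<in> K \<Longrightarrow> a \<le> p \<and> p < q \<and> q \<le> b"
    and bound: "\<And>P. interval_family a b P \<Longrightarrow> P \<subseteq> K \<Longrightarrow> (\<Sum>(p, q)\<in>P. q - p) \<le> B"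
    and N: "negligible N"
  shows "\<exists>T. S \<subseteq> T \<and> T \<in> lmeasurable \<and> measure lebesgue T \<le> B"
proof -
  \<comment> \<open>Intervals are recoded as closed balls with centre \<open>m\<close> and radius
    \<open>r\<close>. The radius is half the length, hence the \<open>2 * e\<close> below.\<close>
  define m r where "m = (\<lambda>(p, q). (p + q) / 2 :: real)" and "r = (\<lambda>(p, q). (q - p) / 2 :: real)"
  have cball: "cball (m (p, q)) (r (p, q)) = {p..q}" for p q
    by (auto simp: m_def r_def cball_def dist_real_def abs_le_iff field_simps)
  have rpos: "0 < r i" if "i \<in> K" for i
    using K that by (cases i) (auto simp: r_def)
  have cov: "\<exists>i. i \<in> K \<and> x \<in> cball (m i) (r i) \<and> r i < e" if x: "x \<in> S - N" and "0 < e" for x e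
  proof -
    obtain p q where "(p, q) \<in> K" "p \<le> x" "x \<le> q" "q - p < 2 * e"
      using cover[OF x, of "2 * e"] \<open>0 < e\<close> by auto
    then show ?thesis
      by (intro exI[of _ "(p, q)"]) (auto simp: cball, simp add: r_def)
  qed
  obtain C where C: "countable C" "C \<subseteq> K"
     "pairwise (\<lambda>i j. disjnt (cball (m i) (r i)) (cball (m j) (r j))) C"
     "negligible ((S - N) - (\<Union>i \<in> C. cball (m i) (r i)))"
    by (rule Vitali_covering_theorem_cballs[of K r "S - N" m, OF rpos cov]) (assumption | rule that)+
  define U where "U = (\<Union>i \<in> C. cball (m i) (r i))"
  have fin: "measure lebesgue (\<Union>i\<in>I. cball (m i) (r i)) \<le> B" if I: "I \<subseteq> C" "finite I" for I
  proof -
    have "interval_family a b I"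
    proof (rule interval_familyI)
      fix s t s' t' assume *: "(s, t) \<in> I" "(s', t') \<in> I" "(s, t) \<noteq> (s', t')"
      then have "disjnt {s..t} {s'..t'}"
        using pairwiseD[OF C(3), of "(s, t)" "(s', t')"] * I(1) by (auto simp: cball)
      moreover have "s < t" "s' < t'"
        using * I C(2) K by blast+
      ultimately show "t \<le> s' \<or> t' \<le> s"
        \<comment> \<open>If the intervals overlapped, the larger left endpoint would lie in both of
          them.\<close>
        by (auto simp: disjnt_iff dest!: spec[of _ "max s s'"])
    qed (use I C K in auto)
    then have "(\<Sum>(p, q)\<in>I. q - p) \<le> B"
      using bound I C by auto
    moreover have "measure lebesgue (\<Union>i\<in>I. cball (m i) (r i)) \<le> (\<Sum>i\<in>I. measure lebesgue (cball (m i) (r i)))"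
      using I by (intro measure_UNION_le) auto
    moreover have "(\<Sum>i\<in>I. measure lebesgue (cball (m i) (r i))) = (\<Sum>(p, q)\<in>I. q - p)"
    proof (rule sum.cong)
      fix i assume "i \<in> I"
      then obtain p q where "i = (p, q)" "p < q"
        using I C K by (metis subsetD prod.collapse)
      then show "measure lebesgue (cball (m i) (r i)) = (case i of (p, q) \<Rightarrow> q - p)"
        by (simp add: cball)
    qed simp
    ultimately show ?thesis
      by linarith
  qed
  have U: "U \<in> lmeasurable" "measure lebesgue U \<le> B"
    unfolding U_def
    by (rule fmeasurable_UN_bound[OF C(1) _ fin] measure_UN_bound[OF C(1) _ fin]; simp)+
  have neg: "negligible (((S - N) - U) \<union> N)"
    using C(4) N unfolding U_def by (rule negligible_Un)
  show ?thesis
  proof (intro exI conjI)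
    show "S \<subseteq> U \<union> (((S - N) - U) \<union> N)"
      by auto
    show "U \<union> (((S - N) - U) \<union> N) \<in> lmeasurable"
      using U neg by (simp add: fmeasurable.Un negligible_imp_measurable)
    show "measure lebesgue (U \<union> (((S - N) - U) \<union> N)) \<le> B"
      using U neg measure_Un_null_set[of U lebesgue] by (simp add: negligible_iff_null_sets fmeasurableD)
  qed
qed

section \<open>Almost everywhere differentiability\<close>

definition variation_bounded :: "real \<Rightarrow> real \<Rightarrow> (real \<Rightarrow> 'a::real_normed_vector) \<Rightarrow> real \<Rightarrow> bool" where
  "variation_bounded a b f W \<longleftrightarrow>
     (\<forall>P. interval_family a b P \<longrightarrow> (\<Sum>(s, t)\<in>P. norm (f t - f s)) \<le> W)"

lemma variation_bounded_nonneg: "variation_bounded a b f W \<Longrightarrow> 0 \<le> W"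
  using interval_family_empty[of a b] unfolding variation_bounded_def by (metis sum.empty)

text \<open>\<open>V x\<close> is the total variation of \<open>f\<close> on \<open>{c..x}\<close>.
  Superadditivity comes from appending the interval \<open>(x, y)\<close> to a family in
  \<open>{c..x}\<close>, near-optimal families from the definition as a supremum.\<close>

lemma variation_function:
  fixes f :: "real \<Rightarrow> real"
  assumes bv: "variation_bounded c d f W" and "c \<le> d"
  obtains V where "\<And>x y. c \<le> x \<Longrightarrow> x \<le> y \<Longrightarrow> y \<le> d \<Longrightarrow> V x + \<bar>f y - f x\<bar> \<le> V y"
    and "\<And>\<epsilon>. \<epsilon> > 0 \<Longrightarrow> \<exists>F. interval_family c d F \<and> (\<Sum>(s, t)\<in>F. \<bar>f t - f s\<bar>) > V d - V c - \<epsilon>"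
proof
  let ?S = "\<lambda>P. \<Sum>(s, t)\<in>P. \<bar>f t - f s\<bar>"
  define V where "V x = (SUP P\<in>{P. interval_family c x P}. ?S P)" for x
  have bdd: "bdd_above (?S ` {P. interval_family c x P})" if "x \<le> d" for x
  proof (rule bdd_aboveI2[of _ _ W])
    fix P assume "P \<in> {P. interval_family c x P}"
    then have P: "interval_family c x P"
      by simp
    have "interval_family c d P"
      by (rule interval_family_subset[OF P order_refl])
        (meson interval_familyD(2,4)[OF P] that order_trans)
    then show "?S P \<le> W"
      using bv by (simp add: variation_bounded_def)
  qed
  have ne: "{P. interval_family c x P} \<noteq> {}" for x
    using interval_family_empty by blast
  show "V x + \<bar>f y - f x\<bar> \<le> V y" if xy: "c \<le> x" "x \<le> y" "y \<le> d" for x y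
  \<comment> \<open>The interval \<open>(x, x)\<close> is not admissible in a family, so this case
    cannot be treated by appending it.\<close>
  proof (cases "x = y")
    case False
    have "?S P \<le> V y - \<bar>f y - f x\<bar>" if P: "interval_family c x P" for P
    proof -
      note D = interval_familyD[OF P]
      have notin: "(x, y) \<notin> P"
        using D(4)[of x y] False xy by auto
      have "interval_family c y (insert (x, y) P)"
      proof (rule interval_familyI)
        fix s t assume "(s, t) \<in> insert (x, y) P"
        then show "c \<le> s \<and> s < t \<and> t \<le> y"
          using D(2-4)[of s t] xy False by auto
      next
        fix s t s' t'
        assume "(s, t) \<in> insert (x, y) P" "(s', t') \<in> insert (x, y) P" "(s, t) \<noteq> (s', t')"
        then show "t \<le> s' \<or> t' \<le> s"
          using D(5)[of s t s' t'] D(4)[of s t] D(4)[of s' t'] by auto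
      qed (use D in auto)
      then have "?S (insert (x, y) P) \<le> V y"
        unfolding V_def by (intro cSUP_upper bdd) (use xy in auto)
      then show ?thesis
        using notin D(1) by simp
    qed
    then have "V x \<le> V y - \<bar>f y - f x\<bar>"
      unfolding V_def[of x] by (intro cSUP_least ne) auto
    then show ?thesis
      by simp
  qed simp
  \<comment> \<open>This says 0 \<le> \<open>V c\<close>, so a family within \<epsilon> of
    \<open>V d\<close> is also good enough for \<open>V d - V c\<close>.\<close>
  have "V c \<ge> ?S {}"
    unfolding V_def by (intro cSUP_upper bdd) (use \<open>c \<le> d\<close> in auto)
  show "\<exists>F. interval_family c d F \<and> ?S F > V d - V c - \<epsilon>" if "\<epsilon> > 0" for \<epsilon>
  proof -
    have "V d - \<epsilon> < V d"
      using that by simp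
    then obtain F where "interval_family c d F" "?S F > V d - \<epsilon>"
      unfolding V_def[of d] less_cSUP_iff[OF ne bdd[OF order_refl]] by auto
    then show ?thesis
      using \<open>V c \<ge> ?S {}\<close> by (intro exI[of _ F]) auto
  qed
qed

text \<open>
  The key step of Austin's proof that functions of bounded variation are differentiable almost
  everywhere: a family that almost realizes the total variation leaves no room for many
  steep intervals against its direction.
\<close>

lemma steep_family_bound:
  fixes f V :: "real \<Rightarrow> real"
  assumes V: "\<And>x y. c \<le> x \<Longrightarrow> x \<le> y \<Longrightarrow> y \<le> d \<Longrightarrow> V x + \<bar>f y - f x\<bar> \<le> V y"
    and "c \<le> d" and F: "interval_family c d F"
    and P: "interval_family c d P"
    and steep: "\<And>p q. (p, q) \<in> P \<Longrightarrow>
       (\<forall>(s, t)\<in>F. q \<le> s \<or> t \<le> p) \<and> \<alpha> * (q - p) \<le> \<bar>f q - f p\<bar> \<or>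
       (\<exists>(s, t)\<in>F. s \<le> p \<and> q \<le> t \<and> \<alpha> * (q - p) \<le> (if f s \<le> f t then f p - f q else f q - f p))"
  shows "\<alpha> * (\<Sum>(p, q)\<in>P. q - p) \<le> V d - V c - (\<Sum>(s, t)\<in>F. \<bar>f t - f s\<bar>)"
proof -
  note FD = interval_familyD[OF F] and PD = interval_familyD[OF P]
  \<comment> \<open>Each interval of \<open>P\<close> either avoids all intervals of
    \<open>F\<close> or lies in exactly one of them; the two kinds are estimated
    differently.\<close>
  define Out where "Out = {(p, q)\<in>P. \<forall>(s, t)\<in>F. q \<le> s \<or> t \<le> p}"
  define In where "In = (\<lambda>(s, t). {(p, q)\<in>P. s \<le> p \<and> q \<le> t})"
  have Out_sub: "Out \<subseteq> P" and In_sub: "In I \<subseteq> P" for I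
    by (auto simp: Out_def In_def)
  have fin: "finite Out" "\<And>I. finite (In I)"
    using finite_subset[OF Out_sub PD(1)] finite_subset[OF In_sub PD(1)] by auto
  have split: "P = Out \<union> (\<Union>I\<in>F. In I)"
    using steep by (fastforce simp: Out_def In_def)
  have disj1: "Out \<inter> (\<Union>I\<in>F. In I) = {}"
    using PD(3) FD(3) by (fastforce simp: Out_def In_def)
  have disj2: "In I \<inter> In J = {}" if "I \<in> F" "J \<in> F" "I \<noteq> J" for I J
  proof (rule ccontr)
    assume "In I \<inter> In J \<noteq> {}"
    then obtain p q where "(p, q) \<in> In I" "(p, q) \<in> In J"
      by auto
    then show False
      using FD(5)[of "fst I" "snd I" "fst J" "snd J"] that PD(3)[of p q] by (auto simp: In_def)
  qed
  have sum_split: "sum h P = sum h Out + (\<Sum>I\<in>F. sum h (In I))" for h :: "real \<times> real \<Rightarrow> real"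
  proof -
    have "sum h P = sum h (Out \<union> (\<Union>I\<in>F. In I))"
      using split by simp
    also have "\<dots> = sum h Out + sum h (\<Union>I\<in>F. In I)"
      using fin FD(1) by (intro sum.union_disjoint disj1) auto
    also have "sum h (\<Union>I\<in>F. In I) = (\<Sum>I\<in>F. sum h (In I))"
      using fin FD(1) disj2 by (intro sum.UNION_disjoint) simp_all
    finally show ?thesis .
  qed
  have out: "\<alpha> * (q - p) \<le> V q - V p" if "(p, q) \<in> Out" for p q
  proof -
    have pq: "(p, q) \<in> P"
      using that by (auto simp: Out_def)
    have "\<alpha> * (q - p) \<le> \<bar>f q - f p\<bar>"
      using steep[OF pq] by (auto split: if_splits)
    then show ?thesis
      using V[of p q] PD(2-4)[OF pq] by auto
  qed
  have "in": "\<alpha> * (\<Sum>(p, q)\<in>In (s, t). q - p) \<le> V t - V s - \<bar>f t - f s\<bar>" if st: "(s, t) \<in> F" for s t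
  proof -
    \<comment> \<open>The sign orients \<open>f\<close> so that it rises from \<open>s\<close> to
      \<open>t\<close>. Then \<open>V - \<sigma> * f\<close> is monotone with total increment
      \<open>V t - V s - \<bar>f t - f s\<bar>\<close>, and an interval steep against this direction
      uses up at least \<open>\<alpha> * (q - p)\<close> of it.\<close>
    define \<sigma> :: real where "\<sigma> = (if f s \<le> f t then 1 else -1)"
    have st': "c \<le> s" "s < t" "t \<le> d"
      using FD st by auto
    have mono: "mono_on {s..t} (\<lambda>x. V x - \<sigma> * f x)"
    proof (rule mono_onI)
      fix x y assume "x \<in> {s..t}" "y \<in> {s..t}" "x \<le> y"
      then show "V x - \<sigma> * f x \<le> V y - \<sigma> * f y"
        using V[of x y] st' by (auto simp: \<sigma>_def)
    qed
    have fam: "interval_family s t (In (s, t))"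
      by (rule interval_family_subset[OF P In_sub]) (auto simp: In_def)
    have "\<alpha> * (q - p) \<le> (V q - \<sigma> * f q) - (V p - \<sigma> * f p)" if "(p, q) \<in> In (s, t)" for p q
    proof -
      have pq: "(p, q) \<in> P" "s \<le> p" "q \<le> t" "p < q"
        using that PD(3) by (auto simp: In_def)
      \<comment> \<open>The steepness hypothesis speaks of some member of \<open>F\<close>;
        non-overlap identifies it with \<open>(s, t)\<close>, so that its direction is the one
        encoded in \<sigma>.\<close>
      have "(s', t') = (s, t)" if "(s', t') \<in> F" "s' \<le> p" "q \<le> t'" for s' t'
        using FD(5)[of s t s' t'] that st pq by auto
      moreover have "\<not> (\<forall>(s, t)\<in>F. q \<le> s \<or> t \<le> p)"
        using st pq by fastforce
      ultimately have "\<alpha> * (q - p) \<le> (if f s \<le> f t then f p - f q else f q - f p)"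
        using steep[OF pq(1)] by auto
      then show ?thesis
        using V[of p q] st' pq by (auto simp: \<sigma>_def split: if_splits)
    qed
    then have "(\<Sum>(p, q)\<in>In (s, t). \<alpha> * (q - p))
        \<le> (\<Sum>(p, q)\<in>In (s, t). (V q - \<sigma> * f q) - (V p - \<sigma> * f p))"
      by (intro sum_mono) auto
    also have "\<dots> \<le> (V t - \<sigma> * f t) - (V s - \<sigma> * f s)"
      by (rule sum_increments_le[OF fam mono]) (use st' in auto)
    also have "\<dots> = V t - V s - \<bar>f t - f s\<bar>"
      by (auto simp: \<sigma>_def)
    finally show ?thesis
      by (simp add: sum_distrib_left case_prod_unfold)
  qed
  have "\<alpha> * (\<Sum>(p, q)\<in>P. q - p)
      = (\<Sum>(p, q)\<in>Out. \<alpha> * (q - p)) + (\<Sum>I\<in>F. \<alpha> * (\<Sum>(p, q)\<in>In I. q - p))"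
    by (simp add: sum_split distrib_left sum_distrib_left case_prod_unfold)
  also have "\<dots> \<le> (\<Sum>(p, q)\<in>Out. V q - V p) + (\<Sum>(s, t)\<in>F. V t - V s - \<bar>f t - f s\<bar>)"
    by (intro add_mono sum_mono) (use out "in" in auto)
  also have "\<dots> = (\<Sum>(s, t)\<in>Out \<union> F. V t - V s) - (\<Sum>(s, t)\<in>F. \<bar>f t - f s\<bar>)"
  proof -
    have "Out \<inter> F = {}"
      using FD(3) by (fastforce simp: Out_def)
    then show ?thesis
      using fin FD(1) by (simp add: sum.union_disjoint sum_subtractf case_prod_unfold)
  qed
  \<comment> \<open>The outer intervals and those of \<open>F\<close> together are again
    non-overlapping, so all their increments of \<open>V\<close> fit into
    \<open>{c..d}\<close>.\<close>
  also have "(\<Sum>(s, t)\<in>Out \<union> F. V t - V s) \<le> V d - V c"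
  proof (rule sum_increments_le)
    show "interval_family c d (Out \<union> F)"
    proof (rule interval_familyI)
      fix s t s' t'
      assume *: "(s, t) \<in> Out \<union> F" "(s', t') \<in> Out \<union> F" "(s, t) \<noteq> (s', t')"
      then show "t \<le> s' \<or> t' \<le> s"
        using PD(5)[of s t s' t'] FD(5)[of s t s' t'] by (auto simp: Out_def)
    next
      fix s t assume "(s, t) \<in> Out \<union> F"
      then show "c \<le> s \<and> s < t \<and> t \<le> d"
        using PD(2-4)[of s t] FD(2-4)[of s t] Out_sub by auto
    qed (use fin FD in auto)
    show "mono_on {c..d} V"
      by (rule mono_onI) (use V in force)
  qed (use \<open>c \<le> d\<close> in auto)
  finally show ?thesis
    by simp
qed

text \<open>At such a point both signs of steepness occur on arbitrarily short intervals, so one can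
  always choose the sign opposing a near-optimal family \<open>F\<close>. The chosen intervals form
  a fine cover whose disjoint subfamilies are short by \<open>steep_family_bound\<close>.\<close>

lemma steep_both_ways_negligible:
  fixes f :: "real \<Rightarrow> real"
  assumes bv: "variation_bounded c d f W" and "c < d" and "\<alpha> > 0"
  shows "negligible {x\<in>{c<..<d}. \<forall>e>0. (\<exists>y. y \<noteq> x \<and> \<bar>y - x\<bar> < e \<and> (f y - f x) / (y - x) > \<alpha>) \<and>
            (\<exists>y. y \<noteq> x \<and> \<bar>y - x\<bar> < e \<and> (f y - f x) / (y - x) < - \<alpha>)}"
    (is "negligible ?E")
  unfolding negligible_outer_le
proof (intro allI impI)
  fix e :: real assume "e > 0"
  obtain V where V: "\<And>x y. c \<le> x \<Longrightarrow> x \<le> y \<Longrightarrow> y \<le> d \<Longrightarrow> V x + \<bar>f y - f x\<bar> \<le> V y"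
    and approx: "\<And>\<epsilon>. \<epsilon> > 0 \<Longrightarrow> \<exists>F. interval_family c d F \<and> (\<Sum>(s, t)\<in>F. \<bar>f t - f s\<bar>) > V d - V c - \<epsilon>"
    by (rule variation_function[OF bv less_imp_le[OF \<open>c < d\<close>]]) (assumption | rule that)+
  \<comment> \<open>The defect \<open>\<alpha> * e\<close> makes the resulting length bound equal to
    \<open>e\<close> after division by \<alpha>.\<close>
  obtain F where F: "interval_family c d F" "(\<Sum>(s, t)\<in>F. \<bar>f t - f s\<bar>) > V d - V c - \<alpha> * e"
    using approx[of "\<alpha> * e"] \<open>\<alpha> > 0\<close> \<open>e > 0\<close> by auto
  note FD = interval_familyD[OF F(1)]
  define ok where "ok p q \<longleftrightarrow> (\<forall>(s, t)\<in>F. q \<le> s \<or> t \<le> p) \<and> \<alpha> * (q - p) \<le> \<bar>f q - f p\<bar> \<or>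
       (\<exists>(s, t)\<in>F. s \<le> p \<and> q \<le> t \<and> \<alpha> * (q - p) \<le> (if f s \<le> f t then f p - f q else f q - f p))" for p q
  define K where "K = {(p, q). c \<le> p \<and> p < q \<and> q \<le> d \<and> ok p q}"
  \<comment> \<open>Away from the finitely many endpoints of \<open>F\<close>, a short interval
    around a point lies inside one interval of \<open>F\<close> or avoids them all.\<close>
  define N where "N = fst ` F \<union> snd ` F"
  have finN: "finite N"
    using FD(1) by (simp add: N_def)
  have K: "c \<le> p \<and> p < q \<and> q \<le> d" if "(p, q) \<in> K" for p q
    using that by (simp add: K_def)
  \<comment> \<open>The point \<open>y\<close> may lie on either side of \<open>x\<close>;
    \<open>min\<close> and \<open>max\<close> order the endpoints and leave the difference quotient
    unchanged.\<close>
  have steepI: "\<alpha> * (max x y - min x y) \<le> f (max x y) - f (min x y)"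
    if "y \<noteq> x" "(f y - f x) / (y - x) > \<alpha>" for x y
    using that by (cases "x < y") (auto simp: max_def min_def field_simps split: if_splits)
  have steepD: "\<alpha> * (max x y - min x y) \<le> f (min x y) - f (max x y)"
    if "y \<noteq> x" "(f y - f x) / (y - x) < -\<alpha>" for x y
    using that by (cases "x < y") (auto simp: max_def min_def field_simps split: if_splits)
  have "\<exists>T. ?E \<subseteq> T \<and> T \<in> lmeasurable \<and> measure lebesgue T \<le> e"
  proof (rule Vitali_interval_cover[of ?E N K c d])
    fix P assume P: "interval_family c d P" "P \<subseteq> K"
    have "\<alpha> * (\<Sum>(p, q)\<in>P. q - p) \<le> V d - V c - (\<Sum>(s, t)\<in>F. \<bar>f t - f s\<bar>)"
    proof (rule steep_family_bound[OF V _ F(1) P(1)])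
      fix p q assume "(p, q) \<in> P"
      then have "ok p q"
        using P(2) by (auto simp: K_def)
      then show "(\<forall>(s, t)\<in>F. q \<le> s \<or> t \<le> p) \<and> \<alpha> * (q - p) \<le> \<bar>f q - f p\<bar> \<or>
          (\<exists>(s, t)\<in>F. s \<le> p \<and> q \<le> t \<and> \<alpha> * (q - p) \<le> (if f s \<le> f t then f p - f q else f q - f p))"
        unfolding ok_def .
    qed (use \<open>c < d\<close> in auto)
    also have "\<dots> \<le> \<alpha> * e"
      using F(2) by simp
    finally show "(\<Sum>(p, q)\<in>P. q - p) \<le> e"
      using \<open>\<alpha> > 0\<close> by simp
  next
    fix x \<eta> :: real assume x: "x \<in> ?E - N" and "\<eta> > 0"
    obtain \<delta> where \<delta>: "\<delta> > 0" "\<And>z. z \<in> insert c (insert d N) \<Longrightarrow> \<delta> \<le> \<bar>z - x\<bar>"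
    proof -
      obtain \<delta> where "\<delta> > 0" "\<forall>z\<in>insert c (insert d N). z \<noteq> x \<longrightarrow> \<delta> \<le> dist x z"
        using finite_set_avoid[of "insert c (insert d N)" x] finN by auto
      then show thesis
        using x by (intro that[of \<delta>]) (auto simp: dist_real_def abs_minus_commute)
    qed
    define \<epsilon> where "\<epsilon> = min \<delta> \<eta>"
    have "\<epsilon> > 0"
      using \<delta>(1) \<open>\<eta> > 0\<close> by (simp add: \<epsilon>_def)
    then obtain y1 y2
      where y1: "y1 \<noteq> x" "\<bar>y1 - x\<bar> < \<epsilon>" "(f y1 - f x) / (y1 - x) > \<alpha>"
        and y2: "y2 \<noteq> x" "\<bar>y2 - x\<bar> < \<epsilon>" "(f y2 - f x) / (y2 - x) < - \<alpha>"
      using x by blast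
    \<comment> \<open>Inside a rising interval of \<open>F\<close> the falling chord is needed.
      Inside a falling interval the rising chord is needed, and outside \<open>F\<close> either
      would do.\<close>
    define sel where "sel \<longleftrightarrow> (\<exists>(s, t)\<in>F. s < x \<and> x < t \<and> f s \<le> f t)"
    define y where "y = (if sel then y2 else y1)"
    have y: "y \<noteq> x" "\<bar>y - x\<bar> < \<epsilon>"
      using y1 y2 by (auto simp: y_def)
    have bds: "c \<le> min x y" "max x y \<le> d" "max x y - min x y < \<eta>" "min x y < max x y"
      using y x \<delta>(2)[of c] \<delta>(2)[of d] by (auto simp: \<epsilon>_def abs_if split: if_splits)
    have FN: "\<delta> \<le> \<bar>s - x\<bar>" "\<delta> \<le> \<bar>t - x\<bar>" if "(s, t) \<in> F" for s t
      using \<delta>(2)[of s] \<delta>(2)[of t] that by (force simp: N_def)+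
    have "(min x y, max x y) \<in> K"
    proof (cases "\<exists>(s, t)\<in>F. s < x \<and> x < t")
      case True
      then obtain s t where st: "(s, t) \<in> F" "s < x" "x < t"
        by auto
      have *: "s \<le> min x y" "max x y \<le> t"
        using FN[OF st(1)] st y by (auto simp: \<epsilon>_def)
      have same: "s' = s \<and> t' = t" if "(s', t') \<in> F" "s' < x" "x < t'" for s' t'
        using FD(5)[of s t s' t'] that st by auto
      have "sel \<longleftrightarrow> (\<exists>s' t'. (s', t') \<in> F \<and> s' < x \<and> x < t' \<and> f s' \<le> f t')"
        by (auto simp: sel_def)
      also have "\<dots> \<longleftrightarrow> f s \<le> f t"
        using same st by blast
      finally have "sel \<longleftrightarrow> f s \<le> f t" .
      then have "\<alpha> * (max x y - min x y)
          \<le> (if f s \<le> f t then f (min x y) - f (max x y) else f (max x y) - f (min x y))"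
        using steepI[OF y1(1,3)] steepD[OF y2(1,3)] by (simp add: y_def)
      with * have "ok (min x y) (max x y)"
        unfolding ok_def by (intro disjI2 bexI[OF _ st(1)]) (simp only: prod.case simp_thms)
      then show ?thesis
        unfolding K_def using bds by blast
    next
      case False
      then have "\<not> sel"
        by (auto simp: sel_def)
      then have "\<alpha> * (max x y - min x y) \<le> \<bar>f (max x y) - f (min x y)\<bar>"
        using steepI[OF y1(1,3)] by (simp add: y_def)
      moreover have "max x y \<le> s \<or> t \<le> min x y" if "(s, t) \<in> F" for s t
        using False FN[OF that] y that by (force simp: \<epsilon>_def abs_if split: if_splits)
      ultimately show ?thesis
        using bds by (auto simp: K_def ok_def)
    qed
    then show "\<exists>p q. (p, q) \<in> K \<and> p \<le> x \<and> x \<le> q \<and> q - p < \<eta>"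
      using bds by (intro exI[of _ "min x y"] exI[of _ "max x y"]) auto
  qed (use K finN in \<open>auto simp: negligible_finite\<close>)
  then show "\<exists>T. ?E \<subseteq> T \<and> T \<in> lmeasurable \<and> measure lebesgue T \<le> e" .
qed

text \<open>Chords of slope at least \<open>M\<close> consume variation at rate \<open>M\<close>, so
  disjoint ones have total length at most \<open>W / M\<close>.\<close>

lemma unbounded_quotient_negligible:
  fixes f :: "real \<Rightarrow> real"
  assumes bv: "variation_bounded c d f W"
  shows "negligible {x\<in>{c<..<d}. \<forall>M. \<forall>e>0. \<exists>y. y \<noteq> x \<and> \<bar>y - x\<bar> < e \<and> \<bar>(f y - f x) / (y - x)\<bar> > M}"
    (is "negligible ?E")
  unfolding negligible_outer_le
proof (intro allI impI)
  fix e :: real assume "e > 0"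
  have "W \<ge> 0"
    by (rule variation_bounded_nonneg[OF bv])
  \<comment> \<open>Chosen so that \<open>W \<le> M * e\<close>; the summand 1 keeps
    \<open>M\<close> positive when \<open>W = 0\<close>.\<close>
  define M where "M = (W + 1) / e"
  have "M > 0"
    using \<open>W \<ge> 0\<close> \<open>e > 0\<close> by (simp add: M_def)
  define K where "K = {(p, q). c \<le> p \<and> p < q \<and> q \<le> d \<and> M * (q - p) \<le> \<bar>f q - f p\<bar>}"
  show "\<exists>T. ?E \<subseteq> T \<and> T \<in> lmeasurable \<and> measure lebesgue T \<le> e"
  proof (rule Vitali_interval_cover[of ?E "{}" K c d])
    fix P assume P: "interval_family c d P" "P \<subseteq> K"
    have "M * (\<Sum>(p, q)\<in>P. q - p) \<le> (\<Sum>(p, q)\<in>P. \<bar>f q - f p\<bar>)"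
      unfolding sum_distrib_left by (rule sum_mono) (use P(2) in \<open>auto simp: K_def\<close>)
    also have "\<dots> \<le> W"
      using bv P(1) by (simp add: variation_bounded_def)
    also have "\<dots> \<le> M * e"
      using \<open>e > 0\<close> by (simp add: M_def)
    finally show "(\<Sum>(p, q)\<in>P. q - p) \<le> e"
      using \<open>M > 0\<close> by simp
  next
    fix x \<eta> :: real assume x: "x \<in> ?E - {}" and "\<eta> > 0"
    define \<epsilon> where "\<epsilon> = Min {\<eta>, x - c, d - x}"
    have eps: "\<epsilon> > 0" "\<epsilon> \<le> \<eta>" "\<epsilon> \<le> x - c" "\<epsilon> \<le> d - x"
      using x \<open>\<eta> > 0\<close> by (auto simp: \<epsilon>_def)
    then obtain y where y: "y \<noteq> x" "\<bar>y - x\<bar> < \<epsilon>" "\<bar>(f y - f x) / (y - x)\<bar> > M"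
      using x by blast
    have *: "M * \<bar>y - x\<bar> \<le> \<bar>f y - f x\<bar>"
      using y by (simp add: abs_divide field_simps)
    show "\<exists>p q. (p, q) \<in> K \<and> p \<le> x \<and> x \<le> q \<and> q - p < \<eta>"
    proof (cases "x < y")
      case True
      then show ?thesis
        using * y eps by (intro exI[of _ x] exI[of _ y]) (auto simp: K_def)
    next
      case False
      then show ?thesis
        using * y eps by (intro exI[of _ y] exI[of _ x]) (auto simp: K_def abs_minus_commute)
    qed
  qed (auto simp: K_def)
qed

text \<open>Subtracting a linear function shifts all difference quotients by \<open>m\<close>, which
  moves two arbitrary thresholds to symmetric ones.\<close>

lemma variation_bounded_diff_linear:
  fixes f :: "real \<Rightarrow> real"
  assumes bv: "variation_bounded c d f W" and "c \<le> d"
  shows "variation_bounded c d (\<lambda>x. f x - m * x) (W + \<bar>m\<bar> * (d - c))"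
  unfolding variation_bounded_def
proof (intro allI impI)
  fix P assume P: "interval_family c d P"
  have "(\<Sum>(s, t)\<in>P. norm (f t - m * t - (f s - m * s)))
      \<le> (\<Sum>(s, t)\<in>P. \<bar>f t - f s\<bar> + \<bar>m\<bar> * (t - s))"
  proof (rule sum_mono, clarify)
    fix s t assume st: "(s, t) \<in> P"
    then have "\<bar>m * (t - s)\<bar> = \<bar>m\<bar> * (t - s)"
      using interval_familyD(3)[OF P st] by (simp add: abs_mult)
    then show "norm (f t - m * t - (f s - m * s)) \<le> \<bar>f t - f s\<bar> + \<bar>m\<bar> * (t - s)"
      using abs_triangle_ineq4[of "f t - f s" "m * (t - s)"] by (simp add: right_diff_distrib algebra_simps)
  qed
  also have "\<dots> = (\<Sum>(s, t)\<in>P. \<bar>f t - f s\<bar>) + \<bar>m\<bar> * (\<Sum>(s, t)\<in>P. t - s)"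
    by (simp add: sum.distrib sum_distrib_left case_prod_unfold)
  also have "\<dots> \<le> W + \<bar>m\<bar> * (d - c)"
    using bv P sum_increments_le[OF P, of "\<lambda>x. x"] \<open>c \<le> d\<close>
    by (intro add_mono mult_left_mono) (auto simp: variation_bounded_def mono_on_def)
  finally show "(\<Sum>(s, t)\<in>P. norm (f t - m * t - (f s - m * s))) \<le> W + \<bar>m\<bar> * (d - c)" .
qed

text \<open>The lower and upper limits of the difference quotient are finite by \<open>bdd\<close>.
  If they differed, two rationals strictly between them would contradict
  \<open>steep\<close>.\<close>

lemma differentiable_if_not_steep:
  fixes f :: "real \<Rightarrow> real"
  assumes bdd: "\<not> (\<forall>M. \<forall>e>0. \<exists>y. y \<noteq> x \<and> \<bar>y - x\<bar> < e \<and> \<bar>(f y - f x) / (y - x)\<bar> > M)"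
    and steep: "\<And>r s. r \<in> \<rat> \<Longrightarrow> s \<in> \<rat> \<Longrightarrow> r < s \<Longrightarrow>
      \<not> (\<forall>e>0. (\<exists>y. y \<noteq> x \<and> \<bar>y - x\<bar> < e \<and> (f y - f x) / (y - x) > s) \<and>
               (\<exists>y. y \<noteq> x \<and> \<bar>y - x\<bar> < e \<and> (f y - f x) / (y - x) < r))"
  shows "f differentiable at x"
proof -
  define Q where "Q y = (f y - f x) / (y - x)" for y
  define L U where "L = Liminf (at x) (\<lambda>y. ereal (Q y))" and "U = Limsup (at x) (\<lambda>y. ereal (Q y))"
  obtain M e where "e > 0" and M: "\<forall>y. \<not> (y \<noteq> x \<and> \<bar>y - x\<bar> < e \<and> \<bar>Q y\<bar> > M)"
    using bdd unfolding Q_def by blast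
  have "- M \<le> Q y \<and> Q y \<le> M" if "y \<noteq> x" "\<bar>y - x\<bar> < e" for y
    using M that by (metis abs_le_D1 abs_le_D2 minus_le_iff not_less)
  with \<open>e > 0\<close> have ev: "\<forall>\<^sub>F y in at x. ereal (-M) \<le> ereal (Q y) \<and> ereal (Q y) \<le> ereal M"
    unfolding eventually_at by (intro exI[of _ e]) (auto simp: dist_real_def)
  have "ereal (-M) \<le> L" "U \<le> ereal M"
    unfolding L_def U_def
    by (rule Liminf_bounded[OF eventually_mono[OF ev]] Limsup_bounded[OF eventually_mono[OF ev]]; simp)+
  have "L \<le> U"
    unfolding L_def U_def by (rule Liminf_le_Limsup) simp
  have "\<not> L < U"
  proof
    assume "L < U"
    then obtain u where u: "L < ereal u" "ereal u < U"
      using ereal_dense2 by blast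
    \<comment> \<open>The outer values \<open>w\<close> and \<open>v\<close> leave room: negating
      \<open>steep\<close> yields only weak bounds by \<open>r\<close> or \<open>s\<close>, which
      must still be strictly separated from the two limits.\<close>
    then obtain v where v: "ereal u < ereal v" "ereal v < U"
      using ereal_dense2 by blast
    obtain w where w: "L < ereal w" "ereal w < ereal u"
      using ereal_dense2[OF u(1)] by blast
    obtain s where s: "s \<in> \<rat>" "u < s" "s < v"
      using v by (auto elim: Rats_dense_in_real[elim_format])
    obtain r where r: "r \<in> \<rat>" "w < r" "r < u"
      using w by (auto elim: Rats_dense_in_real[elim_format])
    obtain e' where "e' > 0"
      and e': "(\<forall>y. y \<noteq> x \<and> \<bar>y - x\<bar> < e' \<longrightarrow> Q y \<le> s) \<or> (\<forall>y. y \<noteq> x \<and> \<bar>y - x\<bar> < e' \<longrightarrow> r \<le> Q y)"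
      using steep[OF r(1) s(1)] r s unfolding Q_def by (meson linorder_not_less less_trans)
    then consider "\<forall>\<^sub>F y in at x. Q y \<le> s" | "\<forall>\<^sub>F y in at x. r \<le> Q y"
      unfolding eventually_at dist_real_def by blast
    then show False
    proof cases
      case 1
      then have "U \<le> ereal s"
        unfolding U_def by (intro Limsup_bounded) auto
      also have "ereal s < ereal v"
        using s by simp
      finally show False
        using v by simp
    next
      case 2
      then have "ereal r \<le> L"
        unfolding L_def by (intro Liminf_bounded) auto
      also have "L < ereal w"
        using w by simp
      finally show False
        using r by simp
    qed
  qed
  then have "U = L"
    using \<open>L \<le> U\<close> by simp
  obtain l where l: "L = ereal l"
    using \<open>ereal (-M) \<le> L\<close> \<open>U \<le> ereal M\<close> \<open>U = L\<close> by (cases L) auto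
  have "((\<lambda>y. ereal (Q y)) \<longlongrightarrow> ereal l) (at x)"
    by (rule Liminf_eq_Limsup) (use l \<open>U = L\<close> in \<open>auto simp: L_def U_def\<close>)
  then have "(Q \<longlongrightarrow> l) (at x)"
    by simp
  then have "(f has_field_derivative l) (at x)"
    by (simp add: has_field_derivative_iff Q_def[abs_def])
  then show ?thesis
    using field_differentiable_imp_differentiable field_differentiable_def by blast
qed

lemma negligible_countable_UN:
  assumes "countable I" and "\<And>i. i \<in> I \<Longrightarrow> negligible (N i)"
  shows "negligible (\<Union>i\<in>I. N i)"
  using null_sets_UN'[of I N lebesgue] assms by (simp add: negligible_iff_null_sets)

theorem variation_bounded_differentiable_ae:
  fixes f :: "real \<Rightarrow> real"
  assumes bv: "variation_bounded c d f W" and "c < d"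
  shows "negligible {x\<in>{c<..<d}. \<not> f differentiable at x}"
proof -
  define E where "E r s = {x\<in>{c<..<d}.
      \<forall>e>0. (\<exists>y. y \<noteq> x \<and> \<bar>y - x\<bar> < e \<and> (f y - f x) / (y - x) > s) \<and>
            (\<exists>y. y \<noteq> x \<and> \<bar>y - x\<bar> < e \<and> (f y - f x) / (y - x) < r)}" for r s
  define E_inf where "E_inf = {x\<in>{c<..<d}. \<forall>M. \<forall>e>0. \<exists>y. y \<noteq> x \<and> \<bar>y - x\<bar> < e \<and> \<bar>(f y - f x) / (y - x)\<bar> > M}"
  have E: "negligible (E r s)" if "r < s" for r s
  proof -
    \<comment> \<open>Midpoint and half-width of the slope gap, so that the thresholds
      \<open>r\<close> and \<open>s\<close> become \<open>- \<alpha>\<close> and \<alpha> after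
      subtracting \<open>m * x\<close>.\<close>
    define m \<alpha> where "m = (r + s) / 2" and "\<alpha> = (s - r) / 2"
    have rs: "s = m + \<alpha>" "r = m - \<alpha>" and "\<alpha> > 0"
      using that by (auto simp: m_def \<alpha>_def field_simps)
    let ?f = "\<lambda>x. f x - m * x"
    have quot: "(?f y - ?f x) / (y - x) = (f y - f x) / (y - x) - m" if "y \<noteq> x" for x y
      using that by (simp add: field_simps)
    have "negligible {x\<in>{c<..<d}. \<forall>e>0. (\<exists>y. y \<noteq> x \<and> \<bar>y - x\<bar> < e \<and> (?f y - ?f x) / (y - x) > \<alpha>) \<and>
            (\<exists>y. y \<noteq> x \<and> \<bar>y - x\<bar> < e \<and> (?f y - ?f x) / (y - x) < - \<alpha>)}"
      by (rule steep_both_ways_negligible[OF variation_bounded_diff_linear[OF bv]])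
        (use \<open>c < d\<close> \<open>\<alpha> > 0\<close> in auto)
    also have "{x\<in>{c<..<d}. \<forall>e>0. (\<exists>y. y \<noteq> x \<and> \<bar>y - x\<bar> < e \<and> (?f y - ?f x) / (y - x) > \<alpha>) \<and>
            (\<exists>y. y \<noteq> x \<and> \<bar>y - x\<bar> < e \<and> (?f y - ?f x) / (y - x) < - \<alpha>)} = E r s"
      unfolding E_def rs
      by (intro Collect_cong conj_cong refl all_cong1 imp_cong ex_cong1) (auto simp: quot)
    finally show ?thesis .
  qed
  define R where "R = {(r, s). r \<in> \<rat> \<and> s \<in> \<rat> \<and> r < (s :: real)}"
  have "countable R"
    by (rule countable_subset[of _ "\<rat> \<times> \<rat>"]) (auto simp: R_def countable_rat)
  then have "negligible (\<Union>(r, s)\<in>R. E r s)"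
    by (intro negligible_countable_UN) (auto simp: R_def E)
  then have neg: "negligible (E_inf \<union> (\<Union>(r, s)\<in>R. E r s))"
    unfolding E_inf_def by (intro negligible_Un unbounded_quotient_negligible[OF bv])
  have sub: "x \<in> E_inf \<union> (\<Union>(r, s)\<in>R. E r s)" if "x \<in> {x\<in>{c<..<d}. \<not> f differentiable at x}" for x
  proof (rule ccontr)
    note x1 = that
    assume x2: "x \<notin> E_inf \<union> (\<Union>(r, s)\<in>R. E r s)"
    have "f differentiable at x"
      by (rule differentiable_if_not_steep) (use x1 x2 in \<open>auto simp: E_inf_def E_def R_def\<close>)
    with x1 show False
      by simp
  qed
  show ?thesis
    by (rule negligible_subset[OF neg]) (rule subsetI, rule sub)
qed

section \<open>Absolutely continuous functions: local variation and differentiability\<close>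

lemma abs_continuous_on_subset:
  assumes "abs_continuous_on a b f" "a \<le> c" "d \<le> b"
  shows "abs_continuous_on c d f"
  unfolding abs_continuous_on_def
proof (intro allI impI)
  fix \<epsilon> :: real assume "\<epsilon> > 0"
  then obtain \<delta> where "\<delta> > 0" and \<delta>: "\<And>(n::nat) s t. (\<forall>i<n. a \<le> s i \<and> s i \<le> t i \<and> t i \<le> b) \<Longrightarrow>
       disjoint_family_on (\<lambda>i. {s i<..<t i}) {..<n} \<Longrightarrow> (\<Sum>i<n. t i - s i) < \<delta> \<Longrightarrow>
       (\<Sum>i<n. norm (f (t i) - f (s i))) < \<epsilon>"
    using assms(1) unfolding abs_continuous_on_def by meson
  show "\<exists>\<delta>>0. \<forall>(n::nat) s t.
       (\<forall>i<n. c \<le> s i \<and> s i \<le> t i \<and> t i \<le> d) \<and>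
       disjoint_family_on (\<lambda>i. {s i<..<t i}) {..<n} \<and> (\<Sum>i<n. t i - s i) < \<delta>
       \<longrightarrow> (\<Sum>i<n. norm (f (t i) - f (s i))) < \<epsilon>"
  proof (intro exI[of _ \<delta>] conjI allI impI \<delta>; (elim conjE)?)
    fix n :: nat and s t i
    assume "\<forall>i<n. c \<le> s i \<and> s i \<le> t i \<and> t i \<le> d" "i < n"
    then show "a \<le> s i" "s i \<le> t i" "t i \<le> b"
      using assms(2,3) by (auto intro: order_trans)
  qed (use \<open>\<delta> > 0\<close> in auto)
qed

text \<open>Passes from indexed sequences of intervals to finite sets of pairs, by enumerating the
  set.\<close>

lemma abs_continuous_on_family:
  assumes "abs_continuous_on a b f" and "\<epsilon> > 0"
  obtains \<delta> where "\<delta> > 0"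
    and "\<And>P. interval_family a b P \<Longrightarrow> (\<Sum>(s, t)\<in>P. t - s) < \<delta> \<Longrightarrow> (\<Sum>(s, t)\<in>P. norm (f t - f s)) < \<epsilon>"
proof -
  obtain \<delta> where "\<delta> > 0" and \<delta>: "\<And>(n::nat) s t. (\<forall>i<n. a \<le> s i \<and> s i \<le> t i \<and> t i \<le> b) \<Longrightarrow>
       disjoint_family_on (\<lambda>i. {s i<..<t i}) {..<n} \<Longrightarrow> (\<Sum>i<n. t i - s i) < \<delta> \<Longrightarrow>
       (\<Sum>i<n. norm (f (t i) - f (s i))) < \<epsilon>"
    using assms unfolding abs_continuous_on_def by meson
  show thesis
  proof (rule that[OF \<open>\<delta> > 0\<close>])
    fix P assume P: "interval_family a b P" "(\<Sum>(s, t)\<in>P. t - s) < \<delta>"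
    obtain h where h: "bij_betw h {..<card P} P"
      using ex_bij_betw_nat_finite[OF interval_familyD(1)[OF P(1)]] by (auto simp: atLeast0LessThan)
    have sum_h: "(\<Sum>i<card P. g (fst (h i)) (snd (h i))) = (\<Sum>(s, t)\<in>P. g s t)" for g :: "real \<Rightarrow> real \<Rightarrow> real"
      using sum.reindex_bij_betw[OF h, of "\<lambda>(s, t). g s t"] by (simp add: case_prod_unfold)
    have hP: "(fst (h i), snd (h i)) \<in> P" if "i < card P" for i
      using bij_betwE[OF h] that by simp
    have "disjoint_family_on (\<lambda>i. {fst (h i)<..<snd (h i)}) {..<card P}"
      unfolding disjoint_family_on_def
    proof (intro ballI impI)
      fix i j assume ij: "i \<in> {..<card P}" "j \<in> {..<card P}" "i \<noteq> j"
      then have "h i \<noteq> h j"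
        using bij_betw_imp_inj_on[OF h] by (auto dest: inj_onD)
      then have "snd (h i) \<le> fst (h j) \<or> snd (h j) \<le> fst (h i)"
        using interval_familyD(5)[OF P(1) hP hP, of i j] ij by (auto simp: prod_eq_iff)
      then show "{fst (h i)<..<snd (h i)} \<inter> {fst (h j)<..<snd (h j)} = {}"
        by auto
    qed
    moreover have "\<forall>i<card P. a \<le> fst (h i) \<and> fst (h i) \<le> snd (h i) \<and> snd (h i) \<le> b"
      using interval_familyD(2-4)[OF P(1) hP] by (auto intro: less_imp_le)
    ultimately have "(\<Sum>i<card P. norm (f (snd (h i)) - f (fst (h i)))) < \<epsilon>"
      using P(2) by (intro \<delta>) (auto simp: sum_h[of "\<lambda>s t. t - s"])
    then show "(\<Sum>(s, t)\<in>P. norm (f t - f s)) < \<epsilon>"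
      by (simp add: sum_h[of "\<lambda>s t. norm (f t - f s)"])
  qed
qed

text \<open>Take \<epsilon> = 1: in an interval shorter than \<delta> every family has total length
  below \<delta>. The local form suffices, since differentiability is local and absolute
  integrability can be glued.\<close>

lemma abs_continuous_on_locally_variation_bounded:
  assumes "abs_continuous_on a b f"
  obtains \<delta> where "\<delta> > 0"
    and "\<And>c d. a \<le> c \<Longrightarrow> c \<le> d \<Longrightarrow> d \<le> b \<Longrightarrow> d - c < \<delta> \<Longrightarrow> variation_bounded c d f 1"
proof -
  obtain \<delta> where "\<delta> > 0" and
    \<delta>: "\<And>P. interval_family a b P \<Longrightarrow> (\<Sum>(s, t)\<in>P. t - s) < \<delta> \<Longrightarrow> (\<Sum>(s, t)\<in>P. norm (f t - f s)) < 1"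
    using abs_continuous_on_family[OF assms zero_less_one] by blast
  show thesis
  proof (rule that[OF \<open>\<delta> > 0\<close>])
    fix c d assume cd: "a \<le> c" "c \<le> d" "d \<le> b" "d - c < \<delta>"
    show "variation_bounded c d f 1"
      unfolding variation_bounded_def
    proof (intro allI impI)
      fix P assume P: "interval_family c d P"
      have "interval_family a b P"
        by (rule interval_family_subset[OF P order_refl])
          (meson interval_familyD(2,4)[OF P] cd order_trans)
      moreover have "(\<Sum>(s, t)\<in>P. t - s) < \<delta>"
        using sum_increments_le[OF P, of "\<lambda>x. x"] cd by (auto simp: mono_on_def)
      ultimately show "(\<Sum>(s, t)\<in>P. norm (f t - f s)) \<le> 1"
        using \<delta> by (intro less_imp_le) auto
    qed
  qed
qed

lemma abs_continuous_on_differentiable_ae_real: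
  fixes f :: "real \<Rightarrow> real"
  assumes "abs_continuous_on a b f"
  shows "negligible {x\<in>{a<..<b}. \<not> f differentiable at x}"
proof -
  obtain \<delta> where "\<delta> > 0"
    and \<delta>: "\<And>c d. a \<le> c \<Longrightarrow> c \<le> d \<Longrightarrow> d \<le> b \<Longrightarrow> d - c < \<delta> \<Longrightarrow> variation_bounded c d f 1"
    using abs_continuous_on_locally_variation_bounded[OF assms] by blast
  \<comment> \<open>Countably many short rational intervals cover the open interval; staying within
    \<open>\<delta> / 2\<close> of \<open>x\<close> on each side keeps the length below
    \<delta>.\<close>
  define R where "R = {(r, s). r \<in> \<rat> \<and> s \<in> \<rat> \<and> a \<le> r \<and> r < s \<and> s \<le> b \<and> s - r < \<delta>}"
  have "countable R"
    by (rule countable_subset[of _ "\<rat> \<times> \<rat>"]) (auto simp: R_def countable_rat)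
  moreover have "negligible {x\<in>{r<..<s}. \<not> f differentiable at x}" if "(r, s) \<in> R" for r s
    by (rule variation_bounded_differentiable_ae[of _ _ _ 1]) (use that \<delta>[of r s] in \<open>auto simp: R_def\<close>)
  ultimately have "negligible (\<Union>(r, s)\<in>R. {x\<in>{r<..<s}. \<not> f differentiable at x})"
    by (intro negligible_countable_UN) auto
  moreover have "{x\<in>{a<..<b}. \<not> f differentiable at x} \<subseteq> (\<Union>(r, s)\<in>R. {x\<in>{r<..<s}. \<not> f differentiable at x})"
  proof
    fix x assume x: "x \<in> {x\<in>{a<..<b}. \<not> f differentiable at x}"
    obtain r where r: "r \<in> \<rat>" "max a (x - \<delta> / 2) < r" "r < x"
      using Rats_dense_in_real[of "max a (x - \<delta> / 2)" x] x \<open>\<delta> > 0\<close> by auto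
    obtain s where s: "s \<in> \<rat>" "x < s" "s < min b (x + \<delta> / 2)"
      using Rats_dense_in_real[of x "min b (x + \<delta> / 2)"] x \<open>\<delta> > 0\<close> by auto
    have "(r, s) \<in> R"
      using r s by (auto simp: R_def)
    moreover have "x \<in> {x\<in>{r<..<s}. \<not> f differentiable at x}"
      using x r s by auto
    ultimately show "x \<in> (\<Union>(r, s)\<in>R. {x\<in>{r<..<s}. \<not> f differentiable at x})"
      by blast
  qed
  ultimately show ?thesis
    by (rule negligible_subset)
qed

lemma abs_continuous_on_inner:
  assumes "abs_continuous_on a b f"
  shows "abs_continuous_on a b (\<lambda>x. f x \<bullet> e)"
  unfolding abs_continuous_on_def
proof (intro allI impI)
  fix \<epsilon> :: real assume "\<epsilon> > 0"
  \<comment> \<open>The summand 1 avoids a division by zero when \<open>e = 0\<close>.\<close>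
  then have "\<epsilon> / (norm e + 1) > 0"
    by (simp add: add_nonneg_pos)
  then obtain \<delta> where "\<delta> > 0" and \<delta>: "\<And>(n::nat) s t. (\<forall>i<n. a \<le> s i \<and> s i \<le> t i \<and> t i \<le> b) \<and>
       disjoint_family_on (\<lambda>i. {s i<..<t i}) {..<n} \<and> (\<Sum>i<n. t i - s i) < \<delta> \<Longrightarrow>
       (\<Sum>i<n. norm (f (t i) - f (s i))) < \<epsilon> / (norm e + 1)"
    using assms(1) unfolding abs_continuous_on_def by meson
  show "\<exists>\<delta>>0. \<forall>(n::nat) s t.
       (\<forall>i<n. a \<le> s i \<and> s i \<le> t i \<and> t i \<le> b) \<and>
       disjoint_family_on (\<lambda>i. {s i<..<t i}) {..<n} \<and> (\<Sum>i<n. t i - s i) < \<delta>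
       \<longrightarrow> (\<Sum>i<n. norm (f (t i) \<bullet> e - f (s i) \<bullet> e)) < \<epsilon>"
  proof (intro exI[of _ \<delta>] conjI allI impI)
    fix n :: nat and s t
    assume "(\<forall>i<n. a \<le> s i \<and> s i \<le> t i \<and> t i \<le> b) \<and>
       disjoint_family_on (\<lambda>i. {s i<..<t i}) {..<n} \<and> (\<Sum>i<n. t i - s i) < \<delta>"
    note * = \<delta>[OF this]
    have "(\<Sum>i<n. norm (f (t i) \<bullet> e - f (s i) \<bullet> e)) \<le> (\<Sum>i<n. norm (f (t i) - f (s i)) * (norm e + 1))"
    proof (rule sum_mono)
      fix i
      have "norm (f (t i) \<bullet> e - f (s i) \<bullet> e) \<le> norm (f (t i) - f (s i)) * norm e"
        using Cauchy_Schwarz_ineq2[of "f (t i) - f (s i)" e] by (simp add: inner_diff_left)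
      also have "\<dots> \<le> norm (f (t i) - f (s i)) * (norm e + 1)"
        by (intro mult_left_mono) auto
      finally show "norm (f (t i) \<bullet> e - f (s i) \<bullet> e) \<le> norm (f (t i) - f (s i)) * (norm e + 1)" .
    qed
    also have "\<dots> < \<epsilon> / (norm e + 1) * (norm e + 1)"
      unfolding sum_distrib_right[symmetric] using * by (intro mult_strict_right_mono) (auto simp: add_nonneg_pos)
    also have "\<dots> = \<epsilon>"
      by (simp add: add_nonneg_eq_0_iff)
    finally show "(\<Sum>i<n. norm (f (t i) \<bullet> e - f (s i) \<bullet> e)) < \<epsilon>" .
  qed (use \<open>\<delta> > 0\<close> in auto)
qed

theorem abs_continuous_on_differentiable_ae:
  fixes f :: "real \<Rightarrow> 'a::euclidean_space"
  assumes "abs_continuous_on a b f"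
  shows "negligible {x\<in>{a<..<b}. \<not> f differentiable at x}"
proof -
  have "negligible (\<Union>i\<in>Basis. {x\<in>{a<..<b}. \<not> (\<lambda>x. f x \<bullet> (i::'a)) differentiable at x})"
    by (intro negligible_Union finite_imageI)
      (auto intro!: abs_continuous_on_differentiable_ae_real[simplified] abs_continuous_on_inner[OF assms])
  then show ?thesis
    by (rule negligible_subset) (auto simp: differentiable_componentwise_within[of f])
qed

section \<open>The fundamental theorem of calculus for absolutely continuous functions\<close>

text \<open>Bridge from the divisions of gauge integration, which are sets of closed intervals, to
  families of endpoint pairs. Degenerate intervals are dropped; by \<open>h x x = 0\<close> they do
  not affect the sum.\<close>

lemma division_interval_family:
  fixes h :: "real \<Rightarrow> real \<Rightarrow> real"
  assumes D: "\<D> division_of S" and S: "S \<subseteq> {a..b}" and h: "\<And>x. h x x = 0"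
  defines "P \<equiv> (\<lambda>K. (Inf K, Sup K)) ` {K\<in>\<D>. Inf K < Sup K}"
  shows "interval_family a b P" and "(\<Sum>(s, t)\<in>P. h s t) = (\<Sum>K\<in>\<D>. h (Inf K) (Sup K))"
proof -
  have K: "K = {Inf K..Sup K}" "Inf K \<le> Sup K" "a \<le> Inf K" "Sup K \<le> b" if K: "K \<in> \<D>" for K
  proof -
    obtain c d where "K = {c..d}" "K \<noteq> {}" "K \<subseteq> S"
      using division_ofD(2,3,4)[OF D K] by (metis box_real(2))
    moreover from this have "c \<le> d"
      by simp
    moreover from calculation have "{c..d} \<subseteq> {a..b}"
      using S by blast
    ultimately show "K = {Inf K..Sup K}" "Inf K \<le> Sup K" "a \<le> Inf K" "Sup K \<le> b"
      by auto
  qed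
  have fin: "finite \<D>"
    by (rule division_ofD(1)[OF D])
  show "interval_family a b P"
  proof (rule interval_familyI)
    show "finite P"
      using fin by (simp add: P_def)
    show "a \<le> s \<and> s < t \<and> t \<le> b" if "(s, t) \<in> P" for s t
      using that K by (auto simp: P_def)
  next
    fix s t s' t' assume "(s, t) \<in> P" "(s', t') \<in> P" and ne: "(s, t) \<noteq> (s', t')"
    then obtain K L where KL: "K \<in> \<D>" "s = Inf K" "t = Sup K" "s < t" "L \<in> \<D>" "s' = Inf L" "t' = Sup L" "s' < t'"
      by (auto simp: P_def)
    then have "interior K \<inter> interior L = {}"
      using division_ofD(5)[OF D] ne by blast
    moreover have "interior K = {s<..<t}" "interior L = {s'<..<t'}"
      using K(1)[of K] K(1)[of L] KL interior_atLeastAtMost_real by metis+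
    ultimately have "{s<..<t} \<inter> {s'<..<t'} = {}"
      by simp
    then show "t \<le> s' \<or> t' \<le> s"
      using KL(4,8) by (simp add: set_eq_iff) (metis dense max_less_iff_conj min_less_iff_conj not_le)
  qed
  have inj: "inj_on (\<lambda>K. (Inf K, Sup K)) {K\<in>\<D>. Inf K < Sup K}"
    by (rule inj_onI) (metis (mono_tags, lifting) K(1) mem_Collect_eq prod.inject)
  have "(\<Sum>(s, t)\<in>P. h s t) = (\<Sum>K | K \<in> \<D> \<and> Inf K < Sup K. h (Inf K) (Sup K))"
    unfolding P_def by (subst sum.reindex[OF inj]) simp
  also have "\<dots> = (\<Sum>K\<in>\<D>. h (Inf K) (Sup K))"
  proof (rule sum.mono_neutral_left[OF fin])
    show "\<forall>K\<in>\<D> - {K \<in> \<D>. Inf K < Sup K}. h (Inf K) (Sup K) = 0"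
      using K(2) h by (force simp: not_less dest: antisym)
  qed auto
  finally show "(\<Sum>(s, t)\<in>P. h s t) = (\<Sum>K\<in>\<D>. h (Inf K) (Sup K))" .
qed

lemma sum_lengths_le_measure:
  assumes P: "interval_family a b P" and sub: "\<And>s t. (s, t) \<in> P \<Longrightarrow> {s<..<t} \<subseteq> U"
    and U: "U \<in> lmeasurable"
  shows "(\<Sum>(s, t)\<in>P. t - s) \<le> measure lebesgue U"
proof -
  have "(\<Sum>(s, t)\<in>P. t - s) = (\<Sum>I\<in>P. measure lebesgue {fst I<..<snd I})"
    using interval_familyD(3)[OF P] by (intro sum.cong) (auto simp: less_imp_le)
  also have "\<dots> = measure lebesgue (\<Union>I\<in>P. {fst I<..<snd I})"
  proof (rule measure_finite_Union[symmetric])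
    show "disjoint_family_on (\<lambda>I. {fst I<..<snd I}) P"
      unfolding disjoint_family_on_def
    proof (intro ballI impI)
      fix I J assume "I \<in> P" "J \<in> P" "I \<noteq> J"
      then have "snd I \<le> fst J \<or> snd J \<le> fst I"
        using interval_familyD(5)[OF P, of "fst I" "snd I" "fst J" "snd J"] by simp
      then show "{fst I<..<snd I} \<inter> {fst J<..<snd J} = {}"
        by auto
    qed
  qed (use interval_familyD(1,3)[OF P] in \<open>auto simp: less_imp_le\<close>)
  also have "\<dots> \<le> measure lebesgue U"
    using sub U interval_familyD(1)[OF P]
    by (intro measure_mono_fmeasurable sets.finite_UN) (auto simp: subset_iff)
  finally show ?thesis .
qed

theorem abs_continuous_FTC:
  fixes u :: "real \<Rightarrow> 'a::euclidean_space"
  assumes ac: "abs_continuous_on a b u" and "a \<le> b"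
  shows "((\<lambda>x. vector_derivative u (at x)) has_integral (u b - u a)) {a..b}"
proof -
  \<comment> \<open>The endpoints are added because differentiability almost everywhere is known
    only in the open interval, and the derivative used is two-sided.\<close>
  define N where "N = {x\<in>{a<..<b}. \<not> u differentiable at x} \<union> {a, b}"
  have N: "negligible N"
    unfolding N_def by (intro negligible_Un abs_continuous_on_differentiable_ae[OF ac]) auto
  \<comment> \<open>With value 0 on \<open>N\<close>, a piece tagged in \<open>N\<close> contributes
    only its increment of \<open>u\<close>, which absolute continuity controls.\<close>
  define g where "g x = (if x \<in> N then 0 else vector_derivative u (at x))" for x
  have der: "(u has_derivative (\<lambda>h. h *\<^sub>R g x)) (at x)" if "x \<in> {a..b} - N" for x
  proof -
    have "u differentiable at x"
      using that by (auto simp: N_def)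
    then show ?thesis
      using that by (simp add: vector_derivative_works g_def has_vector_derivative_def)
  qed
  have "(g has_integral (u b - u a)) {a..b}"
    unfolding has_integral_real
  proof (intro allI impI)
    fix e :: real assume "e > 0"
    \<comment> \<open>The pieces tagged outside \<open>N\<close> will contribute at most
      \<open>\<eta> * (b - a) < e / 2\<close>; the summand 1 covers \<open>a = b\<close>.\<close>
    define \<eta> where "\<eta> = e / (2 * (b - a + 1))"
    have "\<eta> > 0" "\<eta> * (b - a) < e / 2"
      using \<open>e > 0\<close> \<open>a \<le> b\<close> by (auto simp: \<eta>_def field_simps)
    have "e / 2 > 0"
      using \<open>e > 0\<close> by simp
    obtain \<delta> where "\<delta> > 0" and
      \<delta>: "\<And>P. interval_family a b P \<Longrightarrow> (\<Sum>(s, t)\<in>P. t - s) < \<delta> \<Longrightarrow> (\<Sum>(s, t)\<in>P. norm (u t - u s)) < e / 2"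
      using abs_continuous_on_family[OF ac \<open>e / 2 > 0\<close>] by blast
    obtain U where U: "open U" "N \<subseteq> U" "U \<in> lmeasurable" "measure lebesgue U < \<delta>"
    proof -
      obtain U where *: "open U" "N \<subseteq> U" "U - N \<in> lmeasurable" "emeasure lebesgue (U - N) < ennreal \<delta>"
        using sets_lebesgue_outer_open[OF negligible_imp_sets[OF N] \<open>\<delta> > 0\<close>] by blast
      have "U = (U - N) \<union> N"
        using *(2) by blast
      then have U: "U \<in> lmeasurable"
        using *(3) N by (metis fmeasurable.Un negligible_imp_measurable)
      have "measure lebesgue U = measure lebesgue (U - N)"
        using measure_Diff_null_set[of U lebesgue N] N U by (simp add: negligible_iff_null_sets fmeasurableD)
      also have "\<dots> < \<delta>"
        using *(3,4) \<open>\<delta> > 0\<close> by (simp add: emeasure_eq_measure2 ennreal_less_iff)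
      finally show thesis
        using that *(1,2) U by blast
    qed
    have "\<exists>r>0. (x \<in> N \<longrightarrow> ball x r \<subseteq> U) \<and>
        (x \<in> {a..b} - N \<longrightarrow> (\<forall>y. norm (y - x) < r \<longrightarrow> norm (u y - u x - (y - x) *\<^sub>R g x) \<le> \<eta> * norm (y - x)))" for x
    proof (cases "x \<in> N")
      case True
      then show ?thesis
        using U(1,2) by (metis DiffD2 open_contains_ball subsetD)
    next
      case False
      then show ?thesis
        using der[of x] \<open>\<eta> > 0\<close> unfolding has_derivative_at_alt by (metis DiffI zero_less_one)
    qed
    then obtain r where r: "\<And>x. r x > 0" "\<And>x. x \<in> N \<Longrightarrow> ball x (r x) \<subseteq> U"
      "\<And>x y. x \<in> {a..b} - N \<Longrightarrow> norm (y - x) < r x \<Longrightarrow> norm (u y - u x - (y - x) *\<^sub>R g x) \<le> \<eta> * norm (y - x)"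
      by metis
    show "\<exists>\<gamma>. gauge \<gamma> \<and> (\<forall>\<D>. \<D> tagged_division_of {a..b} \<and> \<gamma> fine \<D> \<longrightarrow>
        norm ((\<Sum>(x, k)\<in>\<D>. measure lborel k *\<^sub>R g x) - (u b - u a)) < e)"
    proof (intro exI[of _ "\<lambda>x. ball x (r x)"] conjI allI impI; (elim conjE)?)
      show "gauge (\<lambda>x. ball x (r x))"
        using r(1) by (rule gauge_ball_dependent[rule_format])
    next
      fix p assume p: "p tagged_division_of {a..b}" and fine: "(\<lambda>x. ball x (r x)) fine p"
      have fin: "finite p"
        using p by blast
      have K: "K = {Inf K..Sup K} \<and> x \<in> K \<and> Inf K \<le> x \<and> x \<le> Sup K \<and> K \<subseteq> {a..b} \<and> K \<subseteq> ball x (r x)"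
        if xK: "(x, K) \<in> p" for x K
      proof -
        obtain c d where "K = {c..d}" "x \<in> K" "K \<subseteq> {a..b}"
          using tagged_division_ofD(2-4)[OF p xK] by (metis box_real(2))
        moreover have "K \<subseteq> ball x (r x)"
          using fine xK by (auto simp: fine_def)
        ultimately show ?thesis
          by auto
      qed
      have Ksub: "K \<subseteq> {a..b}" and Kle: "Inf K \<le> Sup K" if "(x, K) \<in> p" for x K
        using K[OF that] by (blast intro: order_trans)+
      define p1 where "p1 = {(x, K)\<in>p. x \<in> N}"
      define p2 where "p2 = {(x, K)\<in>p. x \<notin> N}"
      have p12: "p = p1 \<union> p2" "p1 \<inter> p2 = {}" "finite p1" "finite p2"
        using fin by (auto simp: p1_def p2_def intro: finite_subset[OF _ fin])
      have "(\<Sum>(x, k)\<in>p. measure lborel k *\<^sub>R g x) - (u b - u a)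
          = (\<Sum>(x, k)\<in>p. measure lborel k *\<^sub>R g x - (u (Sup k) - u (Inf k)))"
        using additive_tagged_division_1[OF \<open>a \<le> b\<close> p, of u] by (simp add: sum_subtractf case_prod_unfold)
      also have "\<dots> = (\<Sum>(x, k)\<in>p1. measure lborel k *\<^sub>R g x - (u (Sup k) - u (Inf k)))
          + (\<Sum>(x, k)\<in>p2. measure lborel k *\<^sub>R g x - (u (Sup k) - u (Inf k)))"
        unfolding p12(1) by (rule sum.union_disjoint) (use p12 in auto)
      also have "norm \<dots> \<le> (\<Sum>(x, k)\<in>p1. norm (u (Sup k) - u (Inf k))) + (\<Sum>(x, k)\<in>p2. \<eta> * (Sup k - Inf k))"
      proof (intro order_trans[OF norm_triangle_ineq] add_mono sum_norm_le; clarify)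
        fix x K assume "(x, K) \<in> p1"
        then show "norm (measure lborel K *\<^sub>R g x - (u (Sup K) - u (Inf K))) \<le> norm (u (Sup K) - u (Inf K))"
          by (simp add: p1_def g_def norm_minus_commute)
      next
        fix x K assume "(x, K) \<in> p2"
        then have xK: "(x, K) \<in> p" "x \<notin> N"
          by (auto simp: p2_def)
        note K' = K[OF xK(1)]
        define c d where "c = Inf K" and "d = Sup K"
        have Kcd: "K = {c..d}" "c \<le> x" "x \<le> d"
          using K' unfolding c_def d_def by blast+
        then have "c \<in> K" "d \<in> K"
          by auto
        then have cd: "K = {c..d}" "c \<le> x" "x \<le> d" "c \<in> ball x (r x)" "d \<in> ball x (r x)" "x \<in> {a..b} - N"
          using K' xK(2) Kcd by blast+
        \<comment> \<open>Straddling: the linear approximation at the tag \<open>x\<close> is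
          applied to both endpoints, and the two errors add up to \<eta> times the length since
          \<open>x\<close> lies between them.\<close>
        have "measure lborel K *\<^sub>R g x - (u d - u c) = (u c - u x - (c - x) *\<^sub>R g x) - (u d - u x - (d - x) *\<^sub>R g x)"
          using cd(1-3) by (simp add: algebra_simps)
        also have "norm \<dots> \<le> \<eta> * norm (c - x) + \<eta> * norm (d - x)"
          by (intro order_trans[OF norm_triangle_ineq4] add_mono r(3))
            (use cd in \<open>auto simp: dist_norm norm_minus_commute\<close>)
        also have "\<dots> = \<eta> * (d - c)"
          using cd(2,3) by (simp add: algebra_simps)
        finally show "norm (measure lborel K *\<^sub>R g x - (u (Sup K) - u (Inf K))) \<le> \<eta> * (Sup K - Inf K)"
          by (simp add: c_def d_def)
      qed
      also have "(\<Sum>(x, k)\<in>p1. norm (u (Sup k) - u (Inf k))) < e / 2"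
      proof -
        have part: "p1 tagged_partial_division_of {a..b}"
          by (rule tagged_partial_division_subset[of p]) (use p in \<open>auto simp: p1_def tagged_division_of_def\<close>)
        have tag: "p1 tagged_division_of \<Union>(snd ` p1)"
          by (rule tagged_partial_division_of_Union_self[OF part])
        have div: "snd ` p1 division_of \<Union>(snd ` p1)"
          by (rule partial_division_of_tagged_division[OF part])
        have sub: "\<Union>(snd ` p1) \<subseteq> {a..b}"
          using Ksub by (fastforce simp: p1_def)
        \<comment> \<open>Replacing tagged pairs by their intervals requires a function vanishing on
          all boxes with empty interior, including the empty set, where \<open>Inf\<close> and
          \<open>Sup\<close> give no information.\<close>
        define h where "h k = (if k = {} then 0 else norm (u (Sup k) - u (Inf k)))" for k :: "real set"
        have ne: "k \<noteq> {}" if "(x, k) \<in> p1" for x k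
          using K[of x k] that by (auto simp: p1_def)
        have "(\<Sum>(x, k)\<in>p1. norm (u (Sup k) - u (Inf k))) = (\<Sum>(x, k)\<in>p1. h k)"
          using ne by (intro sum.cong) (auto simp: h_def)
        also have "\<dots> = (\<Sum>k\<in>snd ` p1. h k)"
        proof (rule sum.over_tagged_division_lemma[OF tag])
          fix c d :: real assume "box c d = {}"
          then show "h (cbox c d) = 0"
            by (cases "c = d") (auto simp: h_def)
        qed
        also have "\<dots> = (\<Sum>k\<in>snd ` p1. norm (u (Sup k) - u (Inf k)))"
          using ne by (intro sum.cong) (auto simp: h_def)
        also have "\<dots> < e / 2"
        proof -
          define P where "P = (\<lambda>K. (Inf K, Sup K)) ` {K\<in>snd ` p1. Inf K < Sup K}"
          note fam = division_interval_family[OF div sub, folded P_def]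
          have "interval_family a b P"
            by (rule fam(1)[of "\<lambda>_ _. 0"]) simp
          moreover have "(\<Sum>(s, t)\<in>P. t - s) < \<delta>"
          proof -
            have "(\<Sum>(s, t)\<in>P. t - s) \<le> measure lebesgue U"
            proof (rule sum_lengths_le_measure[OF \<open>interval_family a b P\<close> _ U(3)])
              fix s t assume "(s, t) \<in> P"
              then obtain x K where xK: "(x, K) \<in> p" "x \<in> N" "s = Inf K" "t = Sup K"
                by (auto simp: P_def p1_def)
              then have "{s<..<t} \<subseteq> K"
                using K[OF xK(1)] by (metis greaterThanLessThan_subseteq_atLeastAtMost_iff order_refl)
              then show "{s<..<t} \<subseteq> U"
                using K[OF xK(1)] r(2)[OF xK(2)] by blast
            qed
            then show ?thesis
              using U(4) by simp
          qed
          ultimately have "(\<Sum>(s, t)\<in>P. norm (u t - u s)) < e / 2"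
            by (rule \<delta>)
          then show ?thesis
            using fam(2)[of "\<lambda>s t. norm (u t - u s)"] by simp
        qed
        finally show ?thesis .
      qed
      also have "(\<Sum>(x, k)\<in>p2. \<eta> * (Sup k - Inf k)) \<le> (\<Sum>(x, k)\<in>p. \<eta> * (Sup k - Inf k))"
      proof (rule sum_mono2[OF fin])
        show "p2 \<subseteq> p"
          by (auto simp: p2_def)
        show "0 \<le> (case z of (x, k) \<Rightarrow> \<eta> * (Sup k - Inf k))" if z: "z \<in> p - p2" for z
          using Kle[of "fst z" "snd z"] z \<open>\<eta> > 0\<close> by (auto simp: case_prod_unfold)
      qed
      also have "\<dots> = \<eta> * (b - a)"
        using additive_tagged_division_1[OF \<open>a \<le> b\<close> p, of "\<lambda>x. x"]
        by (simp add: sum_distrib_left[symmetric] case_prod_unfold)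
      finally show "norm ((\<Sum>(x, k)\<in>p. measure lborel k *\<^sub>R g x) - (u b - u a)) < e"
        using \<open>\<eta> * (b - a) < e / 2\<close> by simp
    qed
  qed
  then show ?thesis
    by (rule has_integral_spike[OF N, rotated]) (simp add: g_def)
qed

text \<open>By the fundamental theorem the integrals over the pieces of a division are increments of
  \<open>u\<close>, so on a short interval the sum of their norms is at most the variation bound
  1.\<close>

theorem abs_continuous_derivative_absolutely_integrable:
  fixes u :: "real \<Rightarrow> 'a::euclidean_space"
  assumes ac: "abs_continuous_on a b u" and "a \<le> b"
  shows "(\<lambda>x. vector_derivative u (at x)) absolutely_integrable_on {a..b}"
proof -
  let ?g = "\<lambda>x. vector_derivative u (at x)"
  obtain \<delta> where "\<delta> > 0"
    and \<delta>: "\<And>c d. a \<le> c \<Longrightarrow> c \<le> d \<Longrightarrow> d \<le> b \<Longrightarrow> d - c < \<delta> \<Longrightarrow> variation_bounded c d u 1"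
    using abs_continuous_on_locally_variation_bounded[OF ac] by blast
  have FTC: "(?g has_integral (u d - u c)) {c..d}" if "a \<le> c" "c \<le> d" "d \<le> b" for c d
    by (rule abs_continuous_FTC[OF abs_continuous_on_subset[OF ac]]) (use that in auto)
  have local: "?g absolutely_integrable_on {c..d}" if cd: "a \<le> c" "c \<le> d" "d \<le> b" "d - c < \<delta>" for c d
  proof -
    have "(\<Sum>K\<in>\<D>. norm (integral K ?g)) \<le> 1" if \<D>: "\<D> division_of {c..d}" for \<D>
    proof -
      define P where "P = (\<lambda>K. (Inf K, Sup K)) ` {K\<in>\<D>. Inf K < Sup K}"
      note fam = division_interval_family[OF \<D> order_refl, folded P_def]
      have "norm (integral K ?g) = norm (u (Sup K) - u (Inf K))" if K: "K \<in> \<D>" for K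
      proof -
        obtain s t where st: "K = {s..t}" "K \<noteq> {}" "K \<subseteq> {c..d}"
          using division_ofD(2,3,4)[OF \<D> K] by (metis box_real(2))
        then have "s \<le> t" "a \<le> s" "t \<le> b"
          using cd by auto
        then show ?thesis
          using FTC[of s t] st(1) by (simp add: integral_unique)
      qed
      then have "(\<Sum>K\<in>\<D>. norm (integral K ?g)) = (\<Sum>K\<in>\<D>. norm (u (Sup K) - u (Inf K)))"
        by simp
      also have "\<dots> = (\<Sum>(s, t)\<in>P. norm (u t - u s))"
        using fam(2)[of "\<lambda>s t. norm (u t - u s)"] by simp
      also have "\<dots> \<le> 1"
        using \<delta>[OF cd] fam(1)[of "\<lambda>_ _. 0"] by (simp add: variation_bounded_def)
      finally show ?thesis .
    qed
    then show ?thesis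
      using bounded_variation_absolutely_integrable_interval[of ?g c d 1] FTC[of c d] cd
      by (auto simp: has_integral_iff)
  qed
  \<comment> \<open>The short intervals are glued in steps of \<open>\<delta> / 2\<close>, cut off
    at \<open>b\<close>, until \<open>b\<close> is reached.\<close>
  have "?g absolutely_integrable_on {a..min b (a + real n * (\<delta> / 2))}" for n
  proof (induction n)
    case 0
    then show ?case
      using local[of a a] \<open>a \<le> b\<close> \<open>\<delta> > 0\<close> by simp
  next
    case (Suc n)
    let ?c = "min b (a + real n * (\<delta> / 2))" and ?d = "min b (a + real (Suc n) * (\<delta> / 2))"
    have cd: "a \<le> ?c" "?c \<le> ?d" "?d \<le> b" "?d - ?c < \<delta>"
    proof -
      define y where "y = a + real n * (\<delta> / 2)"
      have y: "a + real (Suc n) * (\<delta> / 2) = y + \<delta> / 2" "a \<le> y"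
        using \<open>\<delta> > 0\<close> by (auto simp: y_def field_simps)
      show "a \<le> ?c" "?c \<le> ?d" "?d \<le> b" "?d - ?c < \<delta>"
        unfolding y(1) unfolding y_def[symmetric] using y(2) \<open>a \<le> b\<close> \<open>\<delta> > 0\<close> by (auto simp: min_def)
    qed
    have "?g absolutely_integrable_on ({a..?c} \<union> {?c..?d})"
      using Suc.IH local[OF cd] by (intro set_integrable_Un) auto
    moreover have "{a..?c} \<union> {?c..?d} = {a..?d}"
      by (rule ivl_disj_un_two_touch(4)[OF cd(1,2)])
    ultimately show ?case
      by metis
  qed
  moreover obtain n where "(b - a) / (\<delta> / 2) < real n"
    using reals_Archimedean2 by blast
  then have "min b (a + real n * (\<delta> / 2)) = b"
    using \<open>\<delta> > 0\<close> by (simp add: field_simps)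
  ultimately show ?thesis
    by metis
qed

section \<open>The weighted inequality\<close>

text \<open>The substitution s = r (t/r)^x turns both logarithms into \<open>L * (1 - x)\<close> and
  \<open>L * x\<close> and ds/s into \<open>L\<close> dx, which leaves the Beta integral on the unit
  interval.\<close>

lemma nn_integral_log_Beta:
  assumes "0 < r" "r < t" "A > 0" "B > 0"
  shows "(\<integral>\<^sup>+s\<in>{r..t}. ennreal (ln (t / s) powr (B - 1) * ln (s / r) powr (A - 1) / s) \<partial>lebesgue)
    = ennreal (Beta A B * ln (t / r) powr (A + B - 1))"
proof -
  define f where "f s = ln (t / s) powr (B - 1) * ln (s / r) powr (A - 1) / s" for s
  define L where "L = ln (t / r)"
  define g where "g x = r * exp (L * x)" for x
  have "L > 0"
    using assms by (simp add: L_def)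
  have g01: "g 0 = r" "g 1 = t"
    using assms by (auto simp: g_def L_def)
  have gpos: "g x > 0" for x
    using assms by (simp add: g_def)
  have fg: "f (g x) * (L * g x) = L powr (A + B - 1) * (x powr (A - 1) * (1 - x) powr (B - 1))"
    if "x \<in> {0..1}" for x
  proof -
    have "ln (g x / r) = L * x"
      using assms by (simp add: g_def)
    moreover have "ln (t / g x) = L * (1 - x)"
      using assms gpos[of x] by (simp add: ln_div g_def L_def ln_mult algebra_simps)
    ultimately have "f (g x) * (L * g x) = (L * (1 - x)) powr (B - 1) * (L * x) powr (A - 1) * L"
      using gpos[of x] by (simp add: f_def)
    also have "\<dots> = (L powr (B - 1) * L powr (A - 1) * L powr 1) * (x powr (A - 1) * (1 - x) powr (B - 1))"
      using that \<open>L > 0\<close> by (simp add: powr_mult)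
    also have "L powr (B - 1) * L powr (A - 1) * L powr 1 = L powr (A + B - 1)"
      unfolding powr_add[symmetric] by (simp add: algebra_simps)
    finally show ?thesis .
  qed
  have "(\<integral>\<^sup>+s\<in>{r..t}. ennreal (f s) \<partial>lebesgue) = (\<integral>\<^sup>+s. ennreal (f s * indicator {g 0..g 1} s) \<partial>lborel)"
    unfolding nn_integral_completion g01 by (intro nn_integral_cong) (auto simp: indicator_def)
  also have "\<dots> = (\<integral>\<^sup>+x. ennreal (f (g x) * (L * g x) * indicator {0..1} x) \<partial>lborel)"
  proof (rule nn_integral_substitution)
    show "set_borel_measurable borel {g 0..g 1} f"
      unfolding set_borel_measurable_def f_def by measurable
    show "(g has_real_derivative L * g x) (at x)" for x
      unfolding g_def by (auto intro!: derivative_eq_intros)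
    show "continuous_on {0..1} (\<lambda>x. L * g x)"
      unfolding g_def by (intro continuous_intros)
  qed (use \<open>L > 0\<close> gpos in \<open>auto intro: less_imp_le\<close>)
  also have "\<dots> = (\<integral>\<^sup>+x. ennreal (L powr (A + B - 1)) *
      (ennreal (x powr (A - 1) * (1 - x) powr (B - 1)) * indicator {0..1} x) \<partial>lborel)"
    by (intro nn_integral_cong) (auto simp: indicator_def fg simp flip: ennreal_mult')
  also have "\<dots> = ennreal (L powr (A + B - 1)) *
      (\<integral>\<^sup>+x. ennreal (x powr (A - 1) * (1 - x) powr (B - 1)) * indicator {0..1} x \<partial>lborel)"
    by (rule nn_integral_cmult) measurable
  also have "(\<integral>\<^sup>+x. ennreal (x powr (A - 1) * (1 - x) powr (B - 1)) * indicator {0..1} x \<partial>lborel)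
      = ennreal (Beta A B)"
    by (rule nn_integral_has_integral_lebesgue'[OF _ has_integral_Beta_real]) (use assms in auto)
  finally show ?thesis
    by (simp add: f_def L_def mult.commute flip: ennreal_mult'')
qed

text \<open>Young's inequality applied pointwise to the normalized functions, then integrated. Upper
  bounds \<open>K\<close> and \<open>J\<close> replace the exact integrals; for \<open>J = 0\<close>
  normalization is impossible, but \<open>g\<close> vanishes almost everywhere.\<close>

lemma Hoelder_nn_integral:
  fixes f g :: "'a \<Rightarrow> real"
  assumes pq: "p > 1" "q > 1" "1 / p + 1 / q = 1"
    and [measurable]: "f \<in> borel_measurable M" "g \<in> borel_measurable M"
    and nonneg: "\<And>x. 0 \<le> f x" "\<And>x. 0 \<le> g x"
    and f: "(\<integral>\<^sup>+x. ennreal (f x powr q) \<partial>M) \<le> ennreal K" and "K > 0"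
    and g: "(\<integral>\<^sup>+x. ennreal (g x powr p) \<partial>M) \<le> ennreal J" and "J \<ge> 0"
  shows "(\<integral>\<^sup>+x. ennreal (f x * g x) \<partial>M) \<le> ennreal (K powr (1 / q) * J powr (1 / p))"
proof (cases "J = 0")
  case True
  then have "(\<integral>\<^sup>+x. ennreal (g x powr p) \<partial>M) = 0"
    using g by simp
  then have "AE x in M. ennreal (g x powr p) = 0"
    by (subst (asm) nn_integral_0_iff_AE) measurable
  then have "(\<integral>\<^sup>+x. ennreal (f x * g x) \<partial>M) = (\<integral>\<^sup>+x. 0 \<partial>M)"
    by (intro nn_integral_cong_AE) (auto elim!: eventually_mono simp: ennreal_eq_0_iff)
  then show ?thesis
    by simp
next
  case False
  then have "J > 0"
    using \<open>J \<ge> 0\<close> by simp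
  define C where "C = K powr (1 / q) * J powr (1 / p)"
  have "C > 0"
    using \<open>K > 0\<close> \<open>J > 0\<close> by (simp add: C_def)
  have young: "f x * g x \<le> C / (q * K) * f x powr q + C / (p * J) * g x powr p" for x
  proof -
    have "(g x / J powr (1 / p)) * (f x / K powr (1 / q))
        \<le> (g x / J powr (1 / p)) powr p / p + (f x / K powr (1 / q)) powr q / q"
      by (rule Youngs_inequality) (use pq nonneg in auto)
    also have "\<dots> = g x powr p / (p * J) + f x powr q / (q * K)"
      using pq nonneg[of x] \<open>K > 0\<close> \<open>J > 0\<close> by (simp add: powr_divide powr_powr mult.commute)
    finally have "f x * g x / C \<le> g x powr p / (p * J) + f x powr q / (q * K)"
      by (simp add: C_def mult.commute)
    then have "f x * g x \<le> (g x powr p / (p * J) + f x powr q / (q * K)) * C"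
      using \<open>C > 0\<close> by (simp add: pos_divide_le_eq)
    then show ?thesis
      by (simp add: algebra_simps)
  qed
  have "(\<integral>\<^sup>+x. ennreal (f x * g x) \<partial>M)
      \<le> (\<integral>\<^sup>+x. ennreal (C / (q * K)) * ennreal (f x powr q) + ennreal (C / (p * J)) * ennreal (g x powr p) \<partial>M)"
    using young pq \<open>C > 0\<close> \<open>K > 0\<close> \<open>J > 0\<close>
    by (intro nn_integral_mono) (simp flip: ennreal_mult' ennreal_plus)
  also have "\<dots> = ennreal (C / (q * K)) * (\<integral>\<^sup>+x. ennreal (f x powr q) \<partial>M)
      + ennreal (C / (p * J)) * (\<integral>\<^sup>+x. ennreal (g x powr p) \<partial>M)"
    by (simp add: nn_integral_add nn_integral_cmult)
  also have "\<dots> \<le> ennreal (C / (q * K)) * ennreal K + ennreal (C / (p * J)) * ennreal J"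
    by (intro add_mono mult_left_mono f g) auto
  also have "\<dots> = ennreal (C * (1 / p + 1 / q))"
    using pq(1,2) \<open>C > 0\<close> \<open>K > 0\<close> \<open>J > 0\<close>
    by (simp add: algebra_simps flip: ennreal_mult' ennreal_plus)
  finally show ?thesis
    using pq(3) by (simp add: C_def)
qed

text \<open>Needed for Fubini's theorem over \<open>lebesgue\<close>; completion keeps the measure
  of the Borel sets in the cover.\<close>

lemma sigma_finite_lebesgue: "sigma_finite_measure (lebesgue :: 'a::euclidean_space measure)"
proof
  obtain A :: "'a set set" where "countable A" "A \<subseteq> sets lborel" "\<Union>A = space lborel" "\<forall>a\<in>A. emeasure lborel a \<noteq> \<infinity>"
    using lborel.sigma_finite_countable by blast
  then show "\<exists>A::'a set set. countable A \<and> A \<subseteq> sets lebesgue \<and> \<Union>A = space lebesgue \<and> (\<forall>a\<in>A. emeasure lebesgue a \<noteq> \<infinity>)"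
    by (intro exI[of _ A]) (auto intro!: sets_completionI_sets)
qed

text \<open>The interval is half-open because at \<open>r = t\<close> the kernel integral over
  \<open>{r..t}\<close> degenerates to 0, so that point must be removed before exchanging
  integrals.\<close>

lemma abs_continuous_lebesgue_FTC:
  fixes u :: "real \<Rightarrow> 'a::euclidean_space"
  assumes ac: "abs_continuous_on a b u" and "a \<le> t" "t \<le> b"
  shows "integrable lebesgue (\<lambda>r. indicator {a..<t} r *\<^sub>R vector_derivative u (at r))"
    and "(\<integral>r. indicator {a..<t} r *\<^sub>R vector_derivative u (at r) \<partial>lebesgue) = u t - u a"
proof -
  let ?g = "\<lambda>r. vector_derivative u (at r)"
  have ac': "abs_continuous_on a t u"
    by (rule abs_continuous_on_subset[OF ac]) (use assms in auto)
  have int: "?g absolutely_integrable_on {a..t}"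
    by (rule abs_continuous_derivative_absolutely_integrable[OF ac' \<open>a \<le> t\<close>])
  have "{a..<t} \<subseteq> {a..t}"
    by auto
  then show int': "integrable lebesgue (\<lambda>r. indicator {a..<t} r *\<^sub>R ?g r)"
    using set_integrable_subset[OF int, of "{a..<t}"] by (simp add: set_integrable_def)
  have "AE r in lebesgue. r \<noteq> t"
    by (intro AE_completion AE_lborel_singleton)
  then have "(\<integral>r. indicator {a..<t} r *\<^sub>R ?g r \<partial>lebesgue) = (LINT r:{a..t}|lebesgue. ?g r)"
    unfolding set_lebesgue_integral_def
    using int int' by (intro integral_cong_AE) (auto simp: set_integrable_def indicator_def elim!: eventually_mono)
  also have "\<dots> = u t - u a"
    using set_lebesgue_integral_eq_integral(2)[OF int] abs_continuous_FTC[OF ac' \<open>a \<le> t\<close>]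
    by (simp add: integral_unique)
  finally show "(\<integral>r. indicator {a..<t} r *\<^sub>R ?g r \<partial>lebesgue) = u t - u a" .
qed

text \<open>
  The Hadamard integral of order \<open>\<alpha>\<close> inverts \<^const>\<open>hadamard_deriv\<close>. In the product of the two
  kernels the intermediate variable integrates out to the constant \<open>\<Gamma>(\<alpha>) \<Gamma>(1 - \<alpha>)\<close>.
\<close>

lemma norm_le_Hadamard_integral:
  fixes u :: "real \<Rightarrow> 'a::euclidean_space"
  assumes "0 < a" and ac: "abs_continuous_on a b u" and "u a = 0"
    and \<alpha>: "0 < \<alpha>" "\<alpha> \<le> 1" and t: "a \<le> t" "t \<le> b"
  shows "ennreal (Gamma \<alpha> * norm (u t))
    \<le> (\<integral>\<^sup>+s\<in>{a..t}. ennreal (ln (t / s) powr (\<alpha> - 1) / s * norm (hadamard_deriv a \<alpha> u s)) \<partial>lebesgue)"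
proof -
  define g where "g r = vector_derivative u (at r)" for r
  define G where "G r = indicator {a..<t} r *\<^sub>R g r" for r
  have G: "integrable lebesgue G" "(\<integral>r. G r \<partial>lebesgue) = u t"
    using abs_continuous_lebesgue_FTC[OF ac t] \<open>u a = 0\<close> by (auto simp: G_def[abs_def] g_def)
  show ?thesis
  proof (cases "\<alpha> = 1")
    case True
    have "ennreal (norm (u t)) \<le> (\<integral>\<^sup>+s. ennreal (norm (G s)) \<partial>lebesgue)"
      using integral_norm_bound_ennreal[OF G(1)] by (simp add: G(2))
    \<comment> \<open>The kernel times \<open>s\<close> is 1 except at \<open>s = t\<close>, where
      \<open>0 powr 0 = 0\<close>; there \<open>G\<close> vanishes as well.\<close>
    also have "\<dots> \<le> (\<integral>\<^sup>+s\<in>{a..t}. ennreal (ln (t / s) powr (\<alpha> - 1) / s * norm (hadamard_deriv a \<alpha> u s)) \<partial>lebesgue)"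
      using \<open>0 < a\<close> by (intro nn_integral_mono)
        (auto simp: True G_def g_def hadamard_deriv_def indicator_def ln_eq_zero_iff)
    finally show ?thesis
      by (simp add: True)
  next
    case neq: False
    with \<alpha> have \<alpha>: "0 < \<alpha>" "\<alpha> < 1"
      by auto
    have \<Gamma>: "Gamma \<alpha> > 0" "Gamma (1 - \<alpha>) > 0"
      using \<alpha> by (auto intro: Gamma_real_pos)
    interpret sigma_finite_measure "lebesgue :: real measure"
      by (rule sigma_finite_lebesgue)
    interpret P: pair_sigma_finite "lebesgue :: real measure" "lebesgue :: real measure" ..
    \<comment> \<open>The product of both kernels, with \<Gamma>(1 - \<alpha>) from the derivative
      included, restricted to the triangle of integration.\<close>
    define c where "c s r = (if a \<le> r \<and> r \<le> s \<and> s \<le> t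
        then ln (t / s) powr (\<alpha> - 1) * ln (s / r) powr (- \<alpha>) / s / Gamma (1 - \<alpha>) else 0)" for s r
    have c_nonneg: "0 \<le> c s r" for s r
      using \<open>0 < a\<close> \<Gamma> by (simp add: c_def)
    have "(\<lambda>z. c (fst z) (snd z)) \<in> borel_measurable (borel \<Otimes>\<^sub>M borel)"
      unfolding c_def by measurable
    \<comment> \<open>\<open>c\<close> is Borel measurable in both variables jointly; this identity
      map transfers that to the product of the completed measures.\<close>
    moreover have "(\<lambda>z. (fst z, snd z)) \<in> (lebesgue :: real measure) \<Otimes>\<^sub>M (lebesgue :: real measure) \<rightarrow>\<^sub>M borel \<Otimes>\<^sub>M borel"
      by (intro measurable_Pair measurable_compose[OF measurable_fst] measurable_compose[OF measurable_snd]
          measurable_completion) auto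
    ultimately have c_meas: "(\<lambda>z. c (fst z) (snd z)) \<in> borel_measurable (lebesgue \<Otimes>\<^sub>M lebesgue)"
      using measurable_compose by fastforce
    have c_meas1: "(\<lambda>s. c s r) \<in> borel_measurable lebesgue" for r
      by (rule measurable_completion) (unfold c_def, measurable)
    \<comment> \<open>The kernel exponents add up to -1, so the power of \<open>ln (t / r)\<close>
      has exponent 0 and only Beta(1 - \<alpha>, \<alpha>) = \<Gamma>(1 - \<alpha>)
      \<Gamma>(\<alpha>) remains, whatever \<open>r\<close> is.\<close>
    have c_int: "(\<integral>\<^sup>+s. ennreal (c s r) \<partial>lebesgue) = ennreal (Gamma \<alpha>)" if r: "r \<in> {a..<t}" for r
    proof -
      have "(\<integral>\<^sup>+s. ennreal (c s r) \<partial>lebesgue)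
          = (\<integral>\<^sup>+s. ennreal (1 / Gamma (1 - \<alpha>)) *
              (ennreal (ln (t / s) powr (\<alpha> - 1) * ln (s / r) powr (1 - \<alpha> - 1) / s) * indicator {r..t} s) \<partial>lebesgue)"
        using r \<Gamma> by (intro nn_integral_cong)
          (auto simp: c_def indicator_def divide_inverse mult.commute simp flip: ennreal_mult')
      also have "\<dots> = ennreal (1 / Gamma (1 - \<alpha>)) *
          (\<integral>\<^sup>+s\<in>{r..t}. ennreal (ln (t / s) powr (\<alpha> - 1) * ln (s / r) powr (1 - \<alpha> - 1) / s) \<partial>lebesgue)"
        by (intro nn_integral_cmult measurable_completion) measurable
      also have "\<dots> = ennreal (1 / Gamma (1 - \<alpha>)) * ennreal (Beta (1 - \<alpha>) \<alpha> * ln (t / r) powr 0)"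
        using nn_integral_log_Beta[of r t "1 - \<alpha>" \<alpha>] r \<alpha> \<open>0 < a\<close> by simp
      also have "\<dots> = ennreal (Gamma \<alpha>)"
        using r \<open>0 < a\<close> \<Gamma> by (simp add: Beta_def ln_eq_zero_iff flip: ennreal_mult')
      finally show ?thesis .
    qed
    define F where "F s r = c s r *\<^sub>R G r" for s r
    have F_int: "integrable (lebesgue \<Otimes>\<^sub>M lebesgue) (\<lambda>(s, r). F s r)"
    proof (rule integrableI_bounded)
      have Gm: "(\<lambda>z. G (snd z)) \<in> borel_measurable ((lebesgue :: real measure) \<Otimes>\<^sub>M lebesgue)"
        by (rule measurable_compose[OF measurable_snd]) (use G in auto)
      show F_meas: "(\<lambda>(s, r). F s r) \<in> borel_measurable (lebesgue \<Otimes>\<^sub>M lebesgue)"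
        unfolding F_def case_prod_unfold by (intro borel_measurable_scaleR c_meas Gm)
      have "(\<integral>\<^sup>+z. ennreal (norm (case z of (s, r) \<Rightarrow> F s r)) \<partial>(lebesgue \<Otimes>\<^sub>M lebesgue))
          = (\<integral>\<^sup>+r. (\<integral>\<^sup>+s. ennreal (norm (F s r)) \<partial>lebesgue) \<partial>lebesgue)"
        using P.nn_integral_snd[of "\<lambda>z. ennreal (norm (case z of (s, r) \<Rightarrow> F s r))"] F_meas by simp
      also have "\<dots> = (\<integral>\<^sup>+r. ennreal (Gamma \<alpha>) * ennreal (norm (G r)) \<partial>lebesgue)"
      proof (intro nn_integral_cong)
        fix r
        have "(\<integral>\<^sup>+s. ennreal (norm (F s r)) \<partial>lebesgue) = (\<integral>\<^sup>+s. ennreal (c s r) * ennreal (norm (G r)) \<partial>lebesgue)"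
          using c_nonneg by (intro nn_integral_cong) (simp add: F_def flip: ennreal_mult')
        also have "\<dots> = (\<integral>\<^sup>+s. ennreal (c s r) \<partial>lebesgue) * ennreal (norm (G r))"
          using c_meas1 by (intro nn_integral_multc) auto
        also have "\<dots> = ennreal (Gamma \<alpha>) * ennreal (norm (G r))"
          using c_int by (cases "r \<in> {a..<t}") (auto simp: G_def)
        finally show "(\<integral>\<^sup>+s. ennreal (norm (F s r)) \<partial>lebesgue) = ennreal (Gamma \<alpha>) * ennreal (norm (G r))" .
      qed
      also have "\<dots> = ennreal (Gamma \<alpha>) * (\<integral>\<^sup>+r. ennreal (norm (G r)) \<partial>lebesgue)"
        using G(1) by (intro nn_integral_cmult) auto
      also have "\<dots> < \<infinity>"
        using G(1) by (auto simp: integrable_iff_bounded ennreal_mult_less_top)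
      finally show "(\<integral>\<^sup>+z. ennreal (norm (case z of (s, r) \<Rightarrow> F s r)) \<partial>(lebesgue \<Otimes>\<^sub>M lebesgue)) < \<infinity>" .
    qed
    have left: "(\<integral>s. F s r \<partial>lebesgue) = Gamma \<alpha> *\<^sub>R G r" for r
    proof (cases "r \<in> {a..<t}")
      case True
      have "integrable lebesgue (\<lambda>s. c s r)"
        using c_meas1 c_nonneg c_int[OF True] by (intro integrableI_nonneg) auto
      moreover have "(\<integral>s. c s r \<partial>lebesgue) = Gamma \<alpha>"
        using c_meas1 c_nonneg c_int[OF True] \<Gamma> by (simp add: integral_eq_nn_integral)
      ultimately show ?thesis
        unfolding F_def by simp
    qed (simp add: F_def G_def)
    \<comment> \<open>Valid for every \<open>s\<close>: scaling commutes with the integral even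
      where it takes its default value, so no exceptional set arises.\<close>
    have right: "norm (\<integral>r. F s r \<partial>lebesgue)
        \<le> ln (t / s) powr (\<alpha> - 1) / s * norm (hadamard_deriv a \<alpha> u s) * indicator {a..t} s" for s
    proof (cases "s \<in> {a..<t}")
      case True
      define H where "H r = indicator {a..s} r *\<^sub>R ((ln (s / r) powr (- \<alpha>) / r) *\<^sub>R (r *\<^sub>R g r))" for r
      have "F s r = (ln (t / s) powr (\<alpha> - 1) / s / Gamma (1 - \<alpha>)) *\<^sub>R H r" for r
        using True \<open>0 < a\<close> by (auto simp: F_def G_def H_def c_def indicator_def)
      then have "(\<integral>r. F s r \<partial>lebesgue) = (ln (t / s) powr (\<alpha> - 1) / s / Gamma (1 - \<alpha>)) *\<^sub>R (\<integral>r. H r \<partial>lebesgue)"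
        by simp
      also have "(\<integral>r. H r \<partial>lebesgue) = Gamma (1 - \<alpha>) *\<^sub>R hadamard_deriv a \<alpha> u s"
        using neq \<Gamma> unfolding hadamard_deriv_def set_lebesgue_integral_def H_def g_def by simp
      finally have "(\<integral>r. F s r \<partial>lebesgue) = (ln (t / s) powr (\<alpha> - 1) / s) *\<^sub>R hadamard_deriv a \<alpha> u s"
        using \<Gamma> by simp
      then show ?thesis
        using True \<open>0 < a\<close> by simp
    next
      case False
      \<comment> \<open>At \<open>s = t\<close> this relies on \<open>ln 1 = 0\<close> and
        \<open>0 powr (\<alpha> - 1) = 0\<close>.\<close>
      then have "F s r = 0" for r
        using \<open>0 < a\<close> by (auto simp: F_def c_def)
      then show ?thesis
        using \<open>0 < a\<close> by (simp add: indicator_def)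
    qed
    have "Gamma \<alpha> *\<^sub>R u t = (\<integral>r. (\<integral>s. F s r \<partial>lebesgue) \<partial>lebesgue)"
      by (simp add: left G(2))
    also have "\<dots> = (\<integral>s. (\<integral>r. F s r \<partial>lebesgue) \<partial>lebesgue)"
      by (rule P.Fubini_integral[OF F_int])
    finally have "ennreal (norm (Gamma \<alpha> *\<^sub>R u t)) \<le> (\<integral>\<^sup>+s. ennreal (norm (\<integral>r. F s r \<partial>lebesgue)) \<partial>lebesgue)"
      using integral_norm_bound_ennreal[OF P.integrable_fst'[OF F_int]] by simp
    also have "\<dots> \<le> (\<integral>\<^sup>+s\<in>{a..t}. ennreal (ln (t / s) powr (\<alpha> - 1) / s * norm (hadamard_deriv a \<alpha> u s)) \<partial>lebesgue)"
    proof (rule nn_integral_mono)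
      fix s
      show "ennreal (norm (\<integral>r. F s r \<partial>lebesgue))
          \<le> ennreal (ln (t / s) powr (\<alpha> - 1) / s * norm (hadamard_deriv a \<alpha> u s)) * indicator {a..t} s"
        using right[of s] by (auto simp: indicator_def intro!: ennreal_leI split: if_splits)
    qed
    finally show ?thesis
      using \<Gamma> by simp
  qed
qed

text \<open>A power is monotone in one direction or the other; adding both endpoint values covers
  either sign of the exponent.\<close>

lemma powr_le_endpoints:
  fixes a b s \<gamma> :: real
  assumes "0 < a" "a \<le> s" "s \<le> b"
  shows "s powr \<gamma> \<le> a powr \<gamma> + b powr \<gamma>"
proof (cases "\<gamma> \<ge> 0")
  case True
  then have "s powr \<gamma> \<le> b powr \<gamma>"
    using assms by (intro powr_mono2) auto
  then show ?thesis
    by (simp add: add_increasing)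
next
  case False
  then have "s powr \<gamma> \<le> a powr \<gamma>"
    using assms by (intro powr_mono2') auto
  then show ?thesis
    by (simp add: add_increasing2)
qed

theorem theorem5p7:
  fixes a b p \<alpha> \<gamma> :: real
  assumes "0 < a" and "a < b" and "1 < p" and "1 / p < \<alpha>" and "\<alpha> \<le> 1"
  shows "\<exists>C::real. C > 0 \<and>
    (\<forall>u :: real \<Rightarrow> 'a::{real_normed_field,euclidean_space}.
       abs_continuous_on a b u \<longrightarrow> u a = 0 \<longrightarrow>
       hadamard_deriv a \<alpha> u \<in> weighted_Lp p (\<lambda>x. 1 / x) a b \<longrightarrow>
       weighted_Lp_norm p (\<lambda>_. 1) a b (\<lambda>x. u x /\<^sub>R x powr (\<gamma> + 1))
         \<le> ennreal C *
           weighted_Lp_norm p (\<lambda>x. 1 / x) a b (\<lambda>x. hadamard_deriv a \<alpha> u x /\<^sub>R x powr \<gamma>))"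
proof -
  define q where "q = p / (p - 1)"
  have q: "1 < q" "1 / p + 1 / q = 1"
    using \<open>1 < p\<close> by (auto simp: q_def field_simps)
  have "0 < \<alpha>"
    using assms by (meson less_trans zero_less_divide_1_iff zero_less_one)
  \<comment> \<open>One more than the exponent of the logarithm in the q-th power of the kernel;
    \<beta> > 0 is the condition \<alpha> > 1/p.\<close>
  define \<beta> where "\<beta> = (\<alpha> - 1) * q + 1"
  have "\<beta> > 0"
  proof -
    have "- (1 / q) < \<alpha> - 1"
      using q(2) \<open>1 / p < \<alpha>\<close> by linarith
    then have "- (1 / q) * q < (\<alpha> - 1) * q"
      using q(1) by (intro mult_strict_right_mono) auto
    then show ?thesis
      using q(1) by (simp add: \<beta>_def)
  qed
  \<comment> \<open>\<open>D\<close> and \<open>E\<close> bound x^\<gamma> and x^(-\<gamma>-1) on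
    the interval, \<open>K\<close> bounds the q-th power integral of the kernel weighted by
    \<open>D\<close>, and \<open>S\<close> is the constant in the uniform bound for
    \<open>u\<close>.\<close>
  define D where "D = a powr \<gamma> + b powr \<gamma>"
  define E where "E = a powr - (\<gamma> + 1) + b powr - (\<gamma> + 1)"
  define K where "K = D powr q * (Beta 1 \<beta> * ln (b / a) powr \<beta>)"
  define S where "S = K powr (1 / q) / Gamma \<alpha>"
  have "ln (b / a) > 0"
    using assms by simp
  have "D > 0" "E > 0"
    using assms by (auto simp: D_def E_def add_pos_pos)
  have "Gamma \<alpha> > 0" "Beta 1 \<beta> > 0"
    using \<open>0 < \<alpha>\<close> \<open>\<beta> > 0\<close> by (auto simp: Beta_def intro!: Gamma_real_pos divide_pos_pos mult_pos_pos)
  then have "K > 0" "S > 0"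
    using \<open>D > 0\<close> \<open>ln (b / a) > 0\<close> by (auto simp: K_def S_def)
  define C where "C = (b - a) powr (1 / p) * (E * S)"
  have "C > 0"
    using \<open>a < b\<close> \<open>E > 0\<close> \<open>S > 0\<close> by (simp add: C_def)
  moreover have "weighted_Lp_norm p (\<lambda>_. 1) a b (\<lambda>x. u x /\<^sub>R x powr (\<gamma> + 1))
         \<le> ennreal C * weighted_Lp_norm p (\<lambda>x. 1 / x) a b (\<lambda>x. hadamard_deriv a \<alpha> u x /\<^sub>R x powr \<gamma>)"
    if ac: "abs_continuous_on a b u" and "u a = 0"
      and Lp: "hadamard_deriv a \<alpha> u \<in> weighted_Lp p (\<lambda>x. 1 / x) a b"
    for u :: "real \<Rightarrow> 'a"
  proof -
    define w where "w = hadamard_deriv a \<alpha> u"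
    define v where "v x = w x /\<^sub>R x powr \<gamma>" for x
    define I where "I = (\<integral>\<^sup>+x\<in>{a<..<b}. ennreal (norm (v x) powr p * (1 / x)) \<partial>lebesgue)"
    have rhs: "weighted_Lp_norm p (\<lambda>x. 1 / x) a b (\<lambda>x. hadamard_deriv a \<alpha> u x /\<^sub>R x powr \<gamma>)
        = (if I = \<infinity> then \<infinity> else ennreal (enn2real I powr (1 / p)))"
      by (simp add: weighted_Lp_norm_def I_def v_def w_def Let_def)
    show ?thesis
    proof (cases "I = \<infinity>")
      case True
      then show ?thesis
        using \<open>C > 0\<close> by (simp add: rhs ennreal_mult_top)
    next
      case False
      define J where "J = enn2real I"
      have "I = ennreal J" "J \<ge> 0"
        using False by (auto simp: J_def less_top)
      \<comment> \<open>The weight 1/s is split as s^(-1/p) s^(-1/q) between \<open>G\<close> and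
        the kernel \<open>F\<close> below, so that Hoelder's inequality applies with unweighted
        Lebesgue measure.\<close>
      define G where "G s = indicator {a<..<b} s * (norm (v s) * s powr (- (1 / p)))" for s
      have G_meas: "G \<in> borel_measurable lebesgue"
      proof -
        have eq: "G = (\<lambda>s. norm (indicator {a<..<b} s *\<^sub>R w s) * (inverse (s powr \<gamma>) * s powr (- (1 / p))))"
          by (auto simp: G_def v_def indicator_def fun_eq_iff)
        have "(\<lambda>s. indicator {a<..<b} s *\<^sub>R w s) \<in> borel_measurable lebesgue"
          using Lp by (simp add: weighted_Lp_def set_borel_measurable_def w_def)
        then have "(\<lambda>s. norm (indicator {a<..<b} s *\<^sub>R w s)) \<in> borel_measurable lebesgue"
          by measurable
        moreover have "(\<lambda>s. inverse (s powr \<gamma>) * s powr (- (1 / p))) \<in> borel_measurable lebesgue"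
          by (rule measurable_completion) measurable
        ultimately show ?thesis
          unfolding eq by (rule borel_measurable_times)
      qed
      have G_int: "(\<integral>\<^sup>+s. ennreal (G s powr p) \<partial>lebesgue) = ennreal J"
      proof -
        have "ennreal (G s powr p) = ennreal (norm (v s) powr p * (1 / s)) * indicator {a<..<b} s" for s
          using \<open>0 < a\<close> \<open>1 < p\<close> by (auto simp: G_def indicator_def powr_mult powr_divide powr_powr powr_minus_divide)
        then show ?thesis
          by (simp only: I_def[symmetric] \<open>I = ennreal J\<close>)
      qed
      have u_bound: "norm (u t) \<le> S * J powr (1 / p)" if t: "t \<in> {a<..<b}" for t
      proof -
        define F where "F s = indicator {a..t} s * (D * ln (t / s) powr (\<alpha> - 1) * s powr (- (1 / q)))" for s
        have F_meas: "F \<in> borel_measurable lebesgue"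
          by (rule measurable_completion) (unfold F_def[abs_def], measurable)
        \<comment> \<open>A Beta integral with first parameter 1. The artificial factor
          \<open>ln (s / a) powr 0\<close> is 1 except at \<open>s = a\<close>, where it is
          0.\<close>
        have "(\<integral>\<^sup>+s. ennreal (F s powr q) \<partial>lebesgue)
            = (\<integral>\<^sup>+s. ennreal (D powr q) * (ennreal (ln (t / s) powr (\<beta> - 1) * ln (s / a) powr (1 - 1) / s) * indicator {a..t} s) \<partial>lebesgue)"
        proof (rule nn_integral_cong_AE)
          have "AE s in lebesgue. s \<noteq> a"
            by (intro AE_completion AE_lborel_singleton)
          then show "AE s in lebesgue. ennreal (F s powr q) = ennreal (D powr q) *
              (ennreal (ln (t / s) powr (\<beta> - 1) * ln (s / a) powr (1 - 1) / s) * indicator {a..t} s)"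
          proof eventually_elim
            case (elim s)
            then show ?case
              using \<open>0 < a\<close> \<open>D > 0\<close> q(1)
              by (auto simp: F_def \<beta>_def indicator_def powr_mult powr_divide powr_powr powr_minus_divide
                  ln_eq_zero_iff simp flip: ennreal_mult')
          qed
        qed
        also have "\<dots> = ennreal (D powr q) *
            (\<integral>\<^sup>+s\<in>{a..t}. ennreal (ln (t / s) powr (\<beta> - 1) * ln (s / a) powr (1 - 1) / s) \<partial>lebesgue)"
          by (intro nn_integral_cmult measurable_completion) measurable
        also have "\<dots> = ennreal (D powr q * (Beta 1 \<beta> * ln (t / a) powr \<beta>))"
          using nn_integral_log_Beta[of a t 1 \<beta>] t \<open>0 < a\<close> \<open>\<beta> > 0\<close> by (simp flip: ennreal_mult')
        also have "\<dots> \<le> ennreal K"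
          unfolding K_def using t \<open>0 < a\<close> \<open>\<beta> > 0\<close> \<open>Beta 1 \<beta> > 0\<close>
          by (intro ennreal_leI mult_left_mono powr_mono2) (auto simp: divide_right_mono)
        finally have F_int: "(\<integral>\<^sup>+s. ennreal (F s powr q) \<partial>lebesgue) \<le> ennreal K" .
        have "ennreal (Gamma \<alpha> * norm (u t))
            \<le> (\<integral>\<^sup>+s\<in>{a..t}. ennreal (ln (t / s) powr (\<alpha> - 1) / s * norm (w s)) \<partial>lebesgue)"
          unfolding w_def
          by (rule norm_le_Hadamard_integral[OF \<open>0 < a\<close> ac \<open>u a = 0\<close> \<open>0 < \<alpha>\<close> \<open>\<alpha> \<le> 1\<close>]) (use t in auto)
        also have "\<dots> \<le> (\<integral>\<^sup>+s. ennreal (F s * G s) \<partial>lebesgue)"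
        proof (rule nn_integral_mono_AE)
          \<comment> \<open>\<open>G\<close> lives on the open interval and vanishes at
            \<open>a\<close>, where the left integrand need not.\<close>
          have "AE s in lebesgue. s \<noteq> a"
            by (intro AE_completion AE_lborel_singleton)
          then show "AE s in lebesgue. ennreal (ln (t / s) powr (\<alpha> - 1) / s * norm (w s)) * indicator {a..t} s
              \<le> ennreal (F s * G s)"
          proof eventually_elim
            case (elim s)
            show ?case
            proof (cases "s \<in> {a..t}")
              case True
              then have s: "a < s" "s \<le> t" "s < b" "0 < s"
                using elim t \<open>0 < a\<close> by auto
              have "s powr (- (1 / q)) * s powr (- (1 / p)) = s powr (- (1 / p + 1 / q))"
                unfolding powr_add[symmetric] by (simp add: algebra_simps)
              then have inv: "s powr (- (1 / q)) * s powr (- (1 / p)) = 1 / s"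
                using s q(2) by (simp add: powr_minus_divide)
              \<comment> \<open>This inserts the weight s^(-\<gamma>), changing \<open>w\<close>
                into \<open>v\<close> at the cost of the constant \<open>D\<close>.\<close>
              have D: "1 \<le> D / s powr \<gamma>"
                using powr_le_endpoints[of a s b \<gamma>] \<open>0 < a\<close> s by (simp add: D_def)
              have "F s * G s = D * ln (t / s) powr (\<alpha> - 1) * norm (v s) * (s powr (- (1 / q)) * s powr (- (1 / p)))"
                using s by (simp add: F_def G_def)
              also have "\<dots> = (ln (t / s) powr (\<alpha> - 1) / s * norm (w s)) * (D / s powr \<gamma>)"
                unfolding inv by (simp add: v_def divide_inverse)
              finally have "ln (t / s) powr (\<alpha> - 1) / s * norm (w s) \<le> F s * G s"
                using mult_left_mono[OF D, of "ln (t / s) powr (\<alpha> - 1) / s * norm (w s)"] s by simp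
              then show ?thesis
                using True by (simp add: ennreal_leI)
            qed simp
          qed
        qed
        also have "\<dots> \<le> ennreal (K powr (1 / q) * J powr (1 / p))"
        proof (rule Hoelder_nn_integral[OF \<open>1 < p\<close> q F_meas G_meas])
          show "0 \<le> F s" "0 \<le> G s" for s
            using \<open>D > 0\<close> by (auto simp: F_def G_def)
        qed (use F_int G_int \<open>K > 0\<close> \<open>J \<ge> 0\<close> in auto)
        finally have "Gamma \<alpha> * norm (u t) \<le> K powr (1 / q) * J powr (1 / p)"
          by (subst (asm) ennreal_le_iff) auto
        then show ?thesis
          using \<open>Gamma \<alpha> > 0\<close> by (simp add: S_def field_simps)
      qed
      \<comment> \<open>Uniform bound for the weighted \<open>u\<close>; integrating its p-th power
        gives the factor \<open>b - a\<close>, whose p-th root is in \<open>C\<close>.\<close>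
      define M where "M = E * (S * J powr (1 / p))"
      have "M \<ge> 0"
        using \<open>E > 0\<close> \<open>S > 0\<close> by (simp add: M_def)
      define L where "L = (\<integral>\<^sup>+x\<in>{a<..<b}. ennreal (norm (u x /\<^sub>R x powr (\<gamma> + 1)) powr p * 1) \<partial>lebesgue)"
      have "L \<le> (\<integral>\<^sup>+x. ennreal (M powr p) * indicator {a<..<b} x \<partial>lebesgue)"
        unfolding L_def
      proof (intro nn_integral_mono)
        fix x
        show "ennreal (norm (u x /\<^sub>R x powr (\<gamma> + 1)) powr p * 1) * indicator {a<..<b} x
            \<le> ennreal (M powr p) * indicator {a<..<b} x"
        proof (cases "x \<in> {a<..<b}")
          case True
          have "norm (u x /\<^sub>R x powr (\<gamma> + 1)) = x powr - (\<gamma> + 1) * norm (u x)"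
            by (simp only: powr_minus norm_scaleR) simp
          also have "\<dots> \<le> M"
            unfolding M_def E_def using True \<open>0 < a\<close> u_bound[OF True]
            by (intro mult_mono powr_le_endpoints) auto
          finally show ?thesis
            using True \<open>1 < p\<close> by (auto intro!: ennreal_leI powr_mono2)
        qed simp
      qed
      also have "\<dots> = ennreal (M powr p * (b - a))"
        using \<open>a < b\<close> by (simp add: nn_integral_cmult_indicator ennreal_mult'')
      finally have L: "L \<le> ennreal (M powr p * (b - a))" .
      then have "L \<noteq> \<infinity>"
        by (auto simp: top_unique)
      have "enn2real L powr (1 / p) \<le> (M powr p * (b - a)) powr (1 / p)"
        using L \<open>a < b\<close> \<open>1 < p\<close> by (intro powr_mono2 enn2real_leI) auto
      also have "\<dots> = C * J powr (1 / p)"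
        using \<open>E > 0\<close> \<open>S > 0\<close> \<open>J \<ge> 0\<close> \<open>a < b\<close> \<open>1 < p\<close> by (simp add: powr_mult powr_powr M_def C_def)
      finally have "ennreal (enn2real L powr (1 / p)) \<le> ennreal C * ennreal (J powr (1 / p))"
        using \<open>C > 0\<close> by (simp add: ennreal_leI flip: ennreal_mult')
      moreover have "weighted_Lp_norm p (\<lambda>_. 1) a b (\<lambda>x. u x /\<^sub>R x powr (\<gamma> + 1)) = ennreal (enn2real L powr (1 / p))"
        using \<open>L \<noteq> \<infinity>\<close> by (simp add: weighted_Lp_norm_def L_def Let_def)
      ultimately show ?thesis
        using False by (simp add: rhs J_def)
    qed
  qed
  ultimately show ?thesis
    by blast
qed

end
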